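(* Let $\tau=(\tau^1,\tau^2)\in\mathbb{T}\times\mathbb{D}$, $\omega\in\mathbb{T}$ and $\alpha>0$. Suppose that $\tau^1\neq1$ and $\omega\neq1$. The functions $\varphi\in\mathcal{S}_2$ such that $\tau$ is a $B$-point for $\varphi$, $\varphi(\tau)=\omega$ and $\nabla\varphi(\tau)=\begin{pmatrix}\omega\overline{\tau^1}\alpha\\0\end{pmatrix}$ are precisely the functions of the form $$\varphi(\lambda)=\frac{h(z)-\mathrm{i}}{h(z)+\mathrm{i}},\qquad \lambda\in\mathbb{D}^2,$$ where $$z^j=\mathrm{i}\,\frac{1+\lambda^j}{1-\lambda^j}\quad\text{for }j=1,2,$$ and $$h(z)=\mathrm{i}\,\frac{1+\omega}{1-\omega}+\frac{1}{\dfrac{1}{\beta(z^1-x^1)}-g(z)},$$ where $$\beta=\frac{1-\mathrm{Re}\,\tau^1}{1-\mathrm{Re}\,\omega}\,\alpha,\qquad x^1=\mathrm{i}\,\frac{1+\tau^1}{1-\tau^1},$$ and $g$ is a function in $\mathcal{P}_2$ such that $$\lim_{y\to0+}y\,g\left(\mathrm{i}\,\frac{1+\tau^1}{1-\tau^1}+\mathrm{i}y,\ \mathrm{i}\,\frac{1+\tau^2}{1-\tau^2}\right)=0.$$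
   Context: $\mathbb{D}$ is the open unit disk in $\mathbb{C}$, $\mathbb{T}$ the unit circle, $\Pi=\{z\in\mathbb{C}:\mathrm{Im}\,z>0\}$. Superscripts on points of $\mathbb{C}^2$ are coordinate indices: $\lambda=(\lambda^1,\lambda^2)$, $z=(z^1,z^2)$, and $\|\lambda\|=\max\{|\lambda^1|,|\lambda^2|\}$. The Schur class $\mathcal{S}_2$ is the set of analytic functions $\varphi$ on $\mathbb{D}^2$ with $|\varphi|\le1$. The Pick class $\mathcal{P}_2$ is the set of analytic functions on $\Pi^2$ with non-negative imaginary part. A set $S\subset\mathbb{D}^2$ approaches $\tau\in\partial(\mathbb{D}^2)$ nontangentially if $\tau$ lies in the closure of $S$ and $\|\lambda-\tau\|/\mathrm{dist}(\lambda,\mathbb{C}^2\setminus\mathbb{D}^2)$ is bounded for $\lambda\in S$. A nontangential limit at $\tau$ is a limit that exists, with the same value, along every set approaching $\tau$ nontangentially. A point $\tau\in\partial(\mathbb{D}^2)$ is a $B$-point for $\varphi\in\mathcal{S}_2$ if $\liminf_{\lambda\to\tau}\frac{1-|\varphi(\lambda)|}{1-\|\lambda\|}<\infty$ ($\lambda$ ranging over $\mathbb{D}^2$). It is known that $\varphi$ has a nontangential limit of modulus $1$ at each $B$-point $\tau$; it is denoted $\varphi(\tau)$. A point $\tau\in\partial(\mathbb{D}^2)$ is a $C$-point for $\varphi$ if for every set $S\subset\mathbb{D}^2$ approaching $\tau$ nontangentially there are $\omega,\eta^1,\eta^2\in\mathbb{C}$ with $|\omega|=1$ such that $\varphi(\lambda)=\omega+\eta^1(\lambda^1-\tau^1)+\eta^2(\lambda^2-\tau^2)+e(\lambda)$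 for $\lambda\in S$, where $e(\lambda)/\|\lambda-\tau\|\to0$ as $\lambda\to\tau$ in $S$. These quantities are then the same for every such $S$, and the angular gradient is $\nabla\varphi(\tau)=\begin{pmatrix}\eta^1\\\eta^2\end{pmatrix}$. (Every $B$-point of $\varphi$ in $\mathbb{T}\times\mathbb{D}$ is a $C$-point of $\varphi$, so $\nabla\varphi(\tau)$ is defined there.) *)

theory Defs
  imports "HOL-Analysis.Analysis"
begin

definition bidisc :: "(complex \<times> complex) set" where
  "bidisc = ball 0 1 \<times> ball 0 1"

definition upper_half_plane :: "complex set" where
  "upper_half_plane = {z. Im z > 0}"

text \<open>The norm of the product type is Euclidean, whereas nontangential approach and
  \<open>B\<close>-points are phrased with the maximum norm. The two norms induce the same topology, so
  the library's closures, frontiers and limits can be used.\<close>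

definition max_norm :: "complex \<times> complex \<Rightarrow> real" where
  "max_norm l = max (norm (fst l)) (norm (snd l))"

definition max_setdist :: "complex \<times> complex \<Rightarrow> (complex \<times> complex) set \<Rightarrow> real" where
  "max_setdist l A = (INF m\<in>A. max_norm (l - m))"

text \<open>Analyticity in two variables (for open sets): existence of a complex-linear derivative at
  every point.\<close>

definition holomorphic2_on :: "(complex \<times> complex \<Rightarrow> complex) \<Rightarrow> (complex \<times> complex) set \<Rightarrow> bool"
    (infixl "holomorphic2'_on" 50) where
  "f holomorphic2_on U \<longleftrightarrow>
     (\<forall>p\<in>U. \<exists>a b. (f has_derivative (\<lambda>v. a * fst v + b * snd v)) (at p within U))"

text \<open>The members of the following two classes are total functions; only their values on the
  bidisc, respectively on the product of half-planes, matter.\<close>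

definition schur_class2 :: "(complex \<times> complex \<Rightarrow> complex) set" where
  "schur_class2 = {f. f holomorphic2_on bidisc \<and> (\<forall>l\<in>bidisc. norm (f l) \<le> 1)}"

definition pick_class2 :: "(complex \<times> complex \<Rightarrow> complex) set" where
  "pick_class2 = {g. g holomorphic2_on (upper_half_plane \<times> upper_half_plane) \<and>
                     (\<forall>z\<in>upper_half_plane \<times> upper_half_plane. Im (g z) \<ge> 0)}"

definition approaches_nontangentially ::
    "(complex \<times> complex) set \<Rightarrow> complex \<times> complex \<Rightarrow> bool" where
  "approaches_nontangentially S \<tau> \<longleftrightarrow>
     S \<subseteq> bidisc \<and> \<tau> \<in> frontier bidisc \<and> \<tau> \<in> closure S \<and>
     bounded ((\<lambda>l. max_norm (l - \<tau>) / max_setdist l (- bidisc)) ` S)"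

definition has_nontangential_limit ::
    "(complex \<times> complex \<Rightarrow> complex) \<Rightarrow> complex \<times> complex \<Rightarrow> complex \<Rightarrow> bool" where
  "has_nontangential_limit \<phi> \<tau> w \<longleftrightarrow>
     (\<forall>S. approaches_nontangentially S \<tau> \<longrightarrow> (\<phi> \<longlongrightarrow> w) (at \<tau> within S))"

definition B_point :: "(complex \<times> complex \<Rightarrow> complex) \<Rightarrow> complex \<times> complex \<Rightarrow> bool" where
  "B_point \<phi> \<tau> \<longleftrightarrow>
     \<tau> \<in> frontier bidisc \<and>
     Liminf (at \<tau> within bidisc) (\<lambda>l. ereal ((1 - norm (\<phi> l)) / (1 - max_norm l))) < \<infinity>"

definition first_order_expansion ::
    "(complex \<times> complex \<Rightarrow> complex) \<Rightarrow> complex \<times> complex \<Rightarrow> (complex \<times> complex) set \<Rightarrow>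
     complex \<Rightarrow> complex \<times> complex \<Rightarrow> bool" where
  "first_order_expansion \<phi> \<tau> S w \<eta> \<longleftrightarrow>
     ((\<lambda>l. (\<phi> l - (w + fst \<eta> * (fst l - fst \<tau>) + snd \<eta> * (snd l - snd \<tau>)))
            / of_real (max_norm (l - \<tau>))) \<longlongrightarrow> 0) (at \<tau> within S)"

definition C_point :: "(complex \<times> complex \<Rightarrow> complex) \<Rightarrow> complex \<times> complex \<Rightarrow> bool" where
  "C_point \<phi> \<tau> \<longleftrightarrow>
     \<tau> \<in> frontier bidisc \<and>
     (\<forall>S. approaches_nontangentially S \<tau> \<longrightarrow>
        (\<exists>w \<eta>. norm w = 1 \<and> first_order_expansion \<phi> \<tau> S w \<eta>))"

text \<open>The coefficients of the expansion must be common to all \<open>S\<close>: along a thin set such as a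
  line segment the gradient is not determined, so a single \<open>S\<close> does not identify it.\<close>

definition has_angular_gradient ::
    "(complex \<times> complex \<Rightarrow> complex) \<Rightarrow> complex \<times> complex \<Rightarrow> complex \<times> complex \<Rightarrow> bool" where
  "has_angular_gradient \<phi> \<tau> \<eta> \<longleftrightarrow>
     C_point \<phi> \<tau> \<and>
     (\<exists>w. norm w = 1 \<and>
        (\<forall>S. approaches_nontangentially S \<tau> \<longrightarrow> first_order_expansion \<phi> \<tau> S w \<eta>))"

definition disc_to_half_plane :: "complex \<Rightarrow> complex" where
  "disc_to_half_plane l = \<i> * ((1 + l) / (1 - l))"

end

theory Submission
  imports Defs "HOL-Complex_Analysis.Conformal_Mappings"
begin

text \<open>
  Transport \<open>\<phi>\<close> to the product of half-planes by Cayley transforms in both variables and in the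
  value: \<open>h = \<i> (1 + \<phi>) / (1 - \<phi>)\<close> has non-negative imaginary part, and \<open>H = h - c\<close>, where
  \<open>c = \<i> (1 + \<omega>) / (1 - \<omega>)\<close> is real, vanishes in the limit at the boundary point
  \<open>(x, z0)\<close> that corresponds to \<open>(\<tau>1, \<tau>2)\<close>. With \<open>u = z1 - x\<close>, the condition on \<open>\<phi>\<close> says that
  \<open>H / u\<close> tends to \<open>\<beta>\<close> nontangentially, and the condition on \<open>g\<close> is that \<open>g = 1 / (\<beta> u) - 1 / H\<close> be a
  Pick function with \<open>y g\<close> tending to \<open>0\<close> on the vertical half-line above \<open>(x, z0)\<close>.

  Both directions rest on the Schwarz--Pick inequality for functions of two variables
  (\<open>Schwarz_Pick\<close>): Pick functions do not increase pseudohyperbolic distances, where the distance in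
  the product of half-planes is the maximum of those of the coordinates.

  Given \<open>\<phi>\<close>, the point at issue is that \<open>Im g\<close> is non-negative, that is, \<open>Im (- 1 / H)\<close> is at
  least \<open>Im (- 1 / (\<beta> u))\<close>. This is an inequality of Julia type
  (\<open>Julia_inequality\<close>). Compare an arbitrary point \<open>z\<close> with \<open>w = (x + \<i> y, z0)\<close> and let \<open>y\<close> tend to
  \<open>0\<close>. The distance between the first coordinates tends to its supremum \<open>1\<close>, while that between the
  second coordinates is fixed and smaller than \<open>1\<close>, so that eventually only the first
  coordinates count. Thus the one-variable argument applies at every \<open>z2\<close>, although the
  hypothesis concerns \<open>z0\<close> only.

  Given \<open>g\<close>, one has \<open>H / u = \<beta> / (1 - \<beta> u g)\<close>, so what is needed is that \<open>u g\<close> tends to \<open>0\<close> along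
  every nontangential approach, whereas the hypothesis gives this on one half-line. Points of a
  nontangential approach set stay at bounded hyperbolic distance from that half-line, and over
  bounded distances the Schwarz--Pick inequality becomes a Harnack inequality, by which
  \<open>\<bar>g\<bar>\<close> varies by at most a constant factor (\<open>Harnack_inequality\<close>, \<open>nontangentially_negligible\<close>).
\<close>

section \<open>Holomorphic functions of two variables\<close>

lemma open_bidisc: "open bidisc"
  unfolding bidisc_def by (intro open_Times) auto

lemma mem_bidisc_iff: "(a, b) \<in> bidisc \<longleftrightarrow> norm a < 1 \<and> norm b < 1"
  by (auto simp: bidisc_def)

lemma mem_upper_half_plane_iff [simp]: "z \<in> upper_half_plane \<longleftrightarrow> Im z > 0"
  by (simp add: upper_half_plane_def)

lemma open_upper_half_plane: "open upper_half_plane"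
  unfolding upper_half_plane_def by (rule open_halfspace_Im_gt)

lemma holomorphic2_onE:
  assumes "f holomorphic2_on U" "open U" "p \<in> U"
  obtains a b where "(f has_derivative (\<lambda>v. a * fst v + b * snd v)) (at p)"
  using assms unfolding holomorphic2_on_def by (metis at_within_open)

lemma holomorphic2_on_compose:
  assumes f: "f holomorphic2_on U" and U: "open U"
    and a: "a holomorphic_on V" and b: "b holomorphic_on V" and V: "open V"
    and sub: "\<And>x. x \<in> V \<Longrightarrow> (a x, b x) \<in> U"
  shows "(\<lambda>x. f (a x, b x)) holomorphic_on V"
  unfolding holomorphic_on_def
proof
  fix x assume x: "x \<in> V"
  obtain c d where fd: "(f has_derivative (\<lambda>v. c * fst v + d * snd v)) (at (a x, b x))"
    using holomorphic2_onE[OF f U sub[OF x]] .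
  obtain a' where a': "(a has_field_derivative a') (at x)"
    using a x V by (metis DERIV_deriv_iff_field_differentiable holomorphic_on_imp_differentiable_at)
  obtain b' where b': "(b has_field_derivative b') (at x)"
    using b x V by (metis DERIV_deriv_iff_field_differentiable holomorphic_on_imp_differentiable_at)
  have "((\<lambda>x. (a x, b x)) has_derivative (\<lambda>h. (a' * h, b' * h))) (at x)"
    using a' b' by (intro has_derivative_Pair) (auto simp: has_field_derivative_def)
  from has_derivative_compose[OF this fd]
  have "((\<lambda>x. f (a x, b x)) has_derivative (\<lambda>h. c * (a' * h) + d * (b' * h))) (at x)"
    by simp
  moreover have "(\<lambda>h. c * (a' * h) + d * (b' * h)) = (*) (c * a' + d * b')"
    by (auto simp: algebra_simps)
  ultimately have "((\<lambda>x. f (a x, b x)) has_field_derivative (c * a' + d * b')) (at x)"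
    by (simp add: has_field_derivative_def)
  then show "(\<lambda>x. f (a x, b x)) field_differentiable at x within V"
    using field_differentiable_at_within field_differentiable_def by blast
qed

lemma holomorphic2_on_coordinatewise:
  assumes f: "f holomorphic2_on U" and U: "open U"
    and a: "a holomorphic_on V" "open V" and b: "b holomorphic_on W" "open W"
    and sub: "\<And>x y. x \<in> V \<Longrightarrow> y \<in> W \<Longrightarrow> (a x, b y) \<in> U"
  shows "(\<lambda>p. f (a (fst p), b (snd p))) holomorphic2_on (V \<times> W)"
  unfolding holomorphic2_on_def
proof
  fix p assume p: "p \<in> V \<times> W"
  then have x: "fst p \<in> V" and y: "snd p \<in> W" by auto
  obtain c d where fd: "(f has_derivative (\<lambda>v. c * fst v + d * snd v)) (at (a (fst p), b (snd p)))"
    using holomorphic2_onE[OF f U sub[OF x y]] .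
  obtain a' where a': "(a has_field_derivative a') (at (fst p))"
    using a x by (metis DERIV_deriv_iff_field_differentiable holomorphic_on_imp_differentiable_at)
  obtain b' where b': "(b has_field_derivative b') (at (snd p))"
    using b y by (metis DERIV_deriv_iff_field_differentiable holomorphic_on_imp_differentiable_at)
  have "((\<lambda>p. (a (fst p), b (snd p))) has_derivative (\<lambda>h. (a' * fst h, b' * snd h))) (at p)"
    using a' b' unfolding has_field_derivative_def
    by (intro has_derivative_Pair has_derivative_compose[of fst fst _ _ a]
        has_derivative_compose[of snd snd _ _ b]) (auto intro!: derivative_eq_intros)
  from has_derivative_compose[OF this fd]
  have "((\<lambda>p. f (a (fst p), b (snd p))) has_derivative
      (\<lambda>v. (c * a') * fst v + (d * b') * snd v)) (at p)"
    by (simp add: mult.assoc)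
  then show "\<exists>c d. ((\<lambda>p. f (a (fst p), b (snd p))) has_derivative
      (\<lambda>v. c * fst v + d * snd v)) (at p within V \<times> W)"
    using has_derivative_at_withinI by blast
qed

lemma holomorphic2_on_postcompose:
  assumes f: "f holomorphic2_on U" and U: "open U"
    and k: "k holomorphic_on V" "open V" and sub: "\<And>p. p \<in> U \<Longrightarrow> f p \<in> V"
  shows "(\<lambda>p. k (f p)) holomorphic2_on U"
  unfolding holomorphic2_on_def
proof
  fix p assume p: "p \<in> U"
  obtain c d where fd: "(f has_derivative (\<lambda>v. c * fst v + d * snd v)) (at p)"
    using holomorphic2_onE[OF f U p] .
  obtain k' where k': "(k has_derivative (*) k') (at (f p))"
    using k sub[OF p] unfolding has_field_derivative_def[symmetric]
    by (metis DERIV_deriv_iff_field_differentiable holomorphic_on_imp_differentiable_at)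
  from has_derivative_compose[OF fd k']
  have "((\<lambda>p. k (f p)) has_derivative (\<lambda>v. (k' * c) * fst v + (k' * d) * snd v)) (at p)"
    by (simp add: algebra_simps)
  then show "\<exists>c d. ((\<lambda>p. k (f p)) has_derivative (\<lambda>v. c * fst v + d * snd v)) (at p within U)"
    using has_derivative_at_withinI by blast
qed

lemma holomorphic2_on_diff:
  assumes "f holomorphic2_on U" "g holomorphic2_on U"
  shows "(\<lambda>p. f p - g p) holomorphic2_on U"
  unfolding holomorphic2_on_def
proof
  fix p assume p: "p \<in> U"
  obtain a b c d where
    "(f has_derivative (\<lambda>v. a * fst v + b * snd v)) (at p within U)"
    "(g has_derivative (\<lambda>v. c * fst v + d * snd v)) (at p within U)"
    using assms p unfolding holomorphic2_on_def by blast
  from has_derivative_diff[OF this]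
  have "((\<lambda>p. f p - g p) has_derivative (\<lambda>v. (a - c) * fst v + (b - d) * snd v)) (at p within U)"
    by (simp add: algebra_simps)
  then show "\<exists>c d. ((\<lambda>p. f p - g p) has_derivative (\<lambda>v. c * fst v + d * snd v)) (at p within U)"
    by blast
qed

lemma holomorphic2_on_fst: "fst holomorphic2_on U"
  unfolding holomorphic2_on_def
proof
  fix p :: "complex \<times> complex"
  have "(fst has_derivative (\<lambda>v. 1 * fst v + 0 * snd v)) (at p within U)"
    by (auto intro!: derivative_eq_intros)
  then show "\<exists>a b. (fst has_derivative (\<lambda>v. a * fst v + b * snd v)) (at p within U)"
    by blast
qed

lemma holomorphic2_on_cong:
  assumes f: "f holomorphic2_on U" and eq: "\<And>p. p \<in> U \<Longrightarrow> f p = g p"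
  shows "g holomorphic2_on U"
  unfolding holomorphic2_on_def
proof
  fix p assume p: "p \<in> U"
  obtain a b where "(f has_derivative (\<lambda>v. a * fst v + b * snd v)) (at p within U)"
    using f p unfolding holomorphic2_on_def by blast
  then have "(g has_derivative (\<lambda>v. a * fst v + b * snd v)) (at p within U)"
    using has_derivative_transform[OF p, of g f] eq by metis
  then show "\<exists>a b. (g has_derivative (\<lambda>v. a * fst v + b * snd v)) (at p within U)"
    by blast
qed

section \<open>Schwarz--Pick and Harnack inequalities on the product of half-planes\<close>

text \<open>The right-hand side separates the imaginary parts from the pseudohyperbolic distance
  \<open>norm (a - b) / norm (a - cnj b)\<close>; each comparison of such distances below becomes an
  inequality between imaginary parts through this identity.\<close>

lemma norm_diff_square_eq_norm_diff_cnj_square: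
  "(norm (a - b))\<^sup>2 = (norm (a - cnj b))\<^sup>2 - 4 * Im a * Im b"
  by (simp only: cmod_power2) (simp add: power2_eq_square algebra_simps)

lemma norm_diff_less_norm_diff_cnj:
  assumes "Im a > 0" "Im b > 0"
  shows "norm (a - b) < norm (a - cnj b)"
proof -
  have "4 * Im a * Im b > 0" using assms by simp
  then have "(norm (a - b))\<^sup>2 < (norm (a - cnj b))\<^sup>2"
    using norm_diff_square_eq_norm_diff_cnj_square[of a b] by linarith
  then show ?thesis using power2_less_imp_less norm_ge_zero by blast
qed

text \<open>The formula is the inverse of \<open>\<lambda>z. (z - w) / (z - cnj w)\<close>, which carries the half-plane to
  the disc and \<open>w\<close> to \<open>0\<close>.\<close>

lemma Im_half_plane_chart_pos:
  assumes w: "Im w > 0" and \<zeta>: "norm \<zeta> < 1"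
  shows "Im ((w - cnj w * \<zeta>) / (1 - \<zeta>)) > 0"
proof -
  have ne: "1 - \<zeta> \<noteq> 0" using \<zeta> by auto
  have sq: "(Re \<zeta>)\<^sup>2 + (Im \<zeta>)\<^sup>2 < 1"
    using \<zeta> by (metis cmod_power2 norm_ge_zero one_power2 power_strict_mono zero_less_numeral)
  have "Im ((w - cnj w * \<zeta>) / (1 - \<zeta>)) =
      Im w * (1 - ((Re \<zeta>)\<^sup>2 + (Im \<zeta>)\<^sup>2)) / ((Re (1 - \<zeta>))\<^sup>2 + (Im (1 - \<zeta>))\<^sup>2)"
    unfolding Im_divide by (rule arg_cong2[where f = "(/)"]) (simp_all add: power2_eq_square algebra_simps)
  moreover have "(Re (1 - \<zeta>))\<^sup>2 + (Im (1 - \<zeta>))\<^sup>2 > 0"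
    using ne by (metis complex_neq_0)
  ultimately show ?thesis using w sq by simp
qed

text \<open>Reduction to one variable: move \<open>w\<close> to the centre of the bidisc by a chart in each coordinate
  and restrict \<open>G\<close> to the complex line through the centre and the image \<open>c\<close> of \<open>z\<close>. As both
  coordinates of \<open>c\<close> have modulus at most \<open>r\<close>, the parameter \<open>r\<close> of the line \<open>\<lambda>\<zeta>. \<zeta> c / r\<close> yields
  \<open>z\<close>, and the Schwarz lemma at \<open>r\<close> is the claim. Allowing any upper bound \<open>r\<close> of the two
  distances, not only their maximum, avoids the degenerate case \<open>z = w\<close>.\<close>

lemma Schwarz_Pick_strict:
  assumes hol: "G holomorphic2_on (upper_half_plane \<times> upper_half_plane)"
    and pos: "\<And>z. z \<in> upper_half_plane \<times> upper_half_plane \<Longrightarrow> Im (G z) > 0"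
    and z: "Im z1 > 0" "Im z2 > 0" and w: "Im w1 > 0" "Im w2 > 0"
    and r1: "norm (z1 - w1) \<le> r * norm (z1 - cnj w1)"
    and r2: "norm (z2 - w2) \<le> r * norm (z2 - cnj w2)"
    and r: "0 < r" "r < 1"
  shows "norm (G (z1, z2) - G (w1, w2)) \<le> r * norm (G (z1, z2) - cnj (G (w1, w2)))"
proof -
  let ?P = "upper_half_plane"
  \<comment> \<open>The chart carries \<open>0\<close> to \<open>w\<close> and the pseudohyperbolic coordinate \<open>c z w\<close> to \<open>z\<close>.\<close>
  define chart where "chart w \<zeta> = (w - cnj w * \<zeta>) / (1 - \<zeta>)" for w \<zeta> :: complex
  define c where "c z w = (z - w) / (z - cnj w)" for z w :: complex
  have ne: "z - cnj w \<noteq> 0" if "Im z > 0" "Im w > 0" for z w :: complex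
    using that by (auto simp: complex_eq_iff)
  have chart_c: "chart w (c z w) = z" if "Im z > 0" "Im w > 0" for z w
  proof -
    have "w - cnj w \<noteq> 0" using that by (auto simp: complex_eq_iff)
    then show ?thesis
      using ne[OF that] unfolding chart_def c_def
      by (simp add: divide_simps) (simp add: algebra_simps)
  qed
  have c_le: "norm (c z w / r) \<le> 1"
    if "norm (z - w) \<le> r * norm (z - cnj w)" "Im z > 0" "Im w > 0" for z w
    using that ne[OF that(2,3)] r by (simp add: c_def norm_divide norm_mult divide_simps mult.commute)
  define d1 d2 where "d1 = c z1 w1 / r" and "d2 = c z2 w2 / r"
  have d: "norm d1 \<le> 1" "norm d2 \<le> 1"
    using c_le r1 r2 z w by (auto simp: d1_def d2_def)
  have small: "norm (\<zeta> * d) < 1" if "norm \<zeta> < 1" "norm d \<le> 1" for \<zeta> d :: complex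
    using mult_left_mono[OF that(2), of "norm \<zeta>"] that(1) unfolding norm_mult by simp
  define F where "F \<zeta> = G (chart w1 (\<zeta> * d1), chart w2 (\<zeta> * d2))" for \<zeta>
  have chart_hol: "(\<lambda>\<zeta>. chart w (\<zeta> * d)) holomorphic_on ball 0 1" if "norm d \<le> 1" for w d
    unfolding chart_def
    by (intro holomorphic_intros) (use small[OF _ that] in \<open>fastforce\<close>)
  have chart_in: "chart w (\<zeta> * d) \<in> ?P" if "norm \<zeta> < 1" "norm d \<le> 1" "Im w > 0" for w \<zeta> d
    using Im_half_plane_chart_pos[OF that(3) small[OF that(1,2)]] by (simp add: chart_def)
  have F_hol: "F holomorphic_on ball 0 1"
    unfolding F_def using d w chart_in
    by (intro holomorphic2_on_compose[OF hol] chart_hol open_Times open_upper_half_plane) auto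
  have F_pos: "Im (F \<zeta>) > 0" if "norm \<zeta> < 1" for \<zeta>
    unfolding F_def using chart_in[OF that d(1) w(1)] chart_in[OF that d(2) w(2)] by (intro pos) auto
  define f where "f \<zeta> = (F \<zeta> - F 0) / (F \<zeta> - cnj (F 0))" for \<zeta>
  have F0: "F \<zeta> - cnj (F 0) \<noteq> 0" if "norm \<zeta> < 1" for \<zeta>
    using ne[OF F_pos[OF that] F_pos[of 0]] by simp
  have "norm (f r) \<le> norm (of_real r :: complex)"
  proof (rule Schwarz_Lemma(1))
    show "f holomorphic_on ball 0 1"
      unfolding f_def by (intro holomorphic_intros F_hol) (use F0 in auto)
    show "f 0 = 0" by (simp add: f_def)
    show "norm (f \<zeta>) < 1" if "norm \<zeta> < 1" for \<zeta>
      using norm_diff_less_norm_diff_cnj[OF F_pos[OF that] F_pos[of 0]] F0[OF that]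
      by (simp add: f_def norm_divide)
    show "norm (of_real r :: complex) < 1" using r by simp
  qed
  moreover have "F r = G (z1, z2)" "F 0 = G (w1, w2)"
    using r z w by (simp_all add: F_def d1_def d2_def chart_c) (simp add: chart_def)
  ultimately show ?thesis
    using F0[of r] r by (simp add: f_def norm_divide divide_simps)
qed

lemma Schwarz_Pick:
  assumes G: "G \<in> pick_class2"
    and z: "Im z1 > 0" "Im z2 > 0" and w: "Im w1 > 0" "Im w2 > 0"
    and r1: "norm (z1 - w1) \<le> r * norm (z1 - cnj w1)"
    and r2: "norm (z2 - w2) \<le> r * norm (z2 - cnj w2)"
    and r: "0 < r" "r < 1"
  shows "norm (G (z1, z2) - G (w1, w2)) \<le> r * norm (G (z1, z2) - cnj (G (w1, w2)))"
proof -
  let ?P = "upper_half_plane"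
  have hol: "G holomorphic2_on (?P \<times> ?P)" and nonneg: "\<And>z. z \<in> ?P \<times> ?P \<Longrightarrow> Im (G z) \<ge> 0"
    using G by (auto simp: pick_class2_def)
  \<comment> \<open>The values of \<open>G\<close> may be real; adding \<open>\<i> e\<close> makes them admissible for the strict version.\<close>
  have shifted: "norm (G (z1, z2) - G (w1, w2)) \<le>
      r * norm (G (z1, z2) - cnj (G (w1, w2)) + 2 * \<i> * of_real e)" if "e > 0" for e
  proof -
    have "(\<lambda>p. G p + \<i> * of_real e) holomorphic2_on (?P \<times> ?P)"
      by (rule holomorphic2_on_postcompose[OF hol, of "\<lambda>x. x + \<i> * of_real e" UNIV])
        (auto intro!: open_Times open_upper_half_plane holomorphic_intros)
    moreover have "Im (G z + \<i> * of_real e) > 0" if "z \<in> ?P \<times> ?P" for z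
      using nonneg[OF that] \<open>e > 0\<close> by simp
    ultimately show ?thesis
      using Schwarz_Pick_strict[OF _ _ z w r1 r2 r, of "\<lambda>p. G p + \<i> * of_real e"]
      by (simp add: algebra_simps)
  qed
  show ?thesis
  proof (rule tendsto_lowerbound)
    show "((\<lambda>e. r * norm (G (z1, z2) - cnj (G (w1, w2)) + 2 * \<i> * of_real e)) \<longlongrightarrow>
        r * norm (G (z1, z2) - cnj (G (w1, w2)))) (at_right (0::real))"
      by (auto intro!: tendsto_eq_intros)
    show "\<forall>\<^sub>F e in at_right 0. norm (G (z1, z2) - G (w1, w2)) \<le>
        r * norm (G (z1, z2) - cnj (G (w1, w2)) + 2 * \<i> * of_real e)"
      using eventually_at_right_less[of 0] by eventually_elim (rule shifted)
  qed simp
qed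

text \<open>The numbers \<open>G z - cnj (G w)\<close> and \<open>G z - G w\<close> differ by \<open>2 \<i> Im (G w)\<close>, and the inequality
  of Schwarz and Pick absorbs the former into the latter because \<open>r < 1\<close>.\<close>

lemma Harnack_inequality:
  assumes G: "G \<in> pick_class2"
    and z: "Im z1 > 0" "Im z2 > 0" and w: "Im w1 > 0" "Im w2 > 0"
    and r1: "norm (z1 - w1) \<le> r * norm (z1 - cnj w1)"
    and r2: "norm (z2 - w2) \<le> r * norm (z2 - cnj w2)"
    and r: "0 < r" "r < 1"
  shows "norm (G (z1, z2) - G (w1, w2)) \<le> 2 * r / (1 - r) * Im (G (w1, w2))"
proof -
  let ?z = "G (z1, z2)" and ?w = "G (w1, w2)"
  have "Im ?w \<ge> 0" using G w by (auto simp: pick_class2_def)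
  have eq: "?z - cnj ?w = (?z - ?w) + of_real (2 * Im ?w) * \<i>"
    by (simp add: complex_eq_iff)
  have "norm (?z - cnj ?w) \<le> norm (?z - ?w) + norm (of_real (2 * Im ?w) * \<i>)"
    unfolding eq by (rule norm_triangle_ineq)
  then have "norm (?z - cnj ?w) \<le> norm (?z - ?w) + 2 * Im ?w"
    using \<open>Im ?w \<ge> 0\<close> by (simp add: norm_mult)
  with Schwarz_Pick[OF assms] r
  have "norm (?z - ?w) \<le> r * (norm (?z - ?w) + 2 * Im ?w)"
    by (meson less_imp_le mult_left_mono order_trans)
  then show ?thesis using r by (simp add: field_simps)
qed

lemma pick_class2_constant_if_real_value:
  assumes G: "G \<in> pick_class2" and z: "Im z1 > 0" "Im z2 > 0" and w: "Im w1 > 0" "Im w2 > 0"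
    and 0: "Im (G (w1, w2)) = 0"
  shows "G (z1, z2) = G (w1, w2)"
proof -
  define q where "q z w = norm (z - w) / norm (z - cnj w)" for z w :: complex
  have q: "q z w < 1" "norm (z - w) = q z w * norm (z - cnj w)" if "Im z > 0" "Im w > 0" for z w
  proof -
    have "norm (z - cnj w) > 0"
      using norm_diff_less_norm_diff_cnj[OF that] norm_ge_zero[of "z - w"] by linarith
    then show "q z w < 1" "norm (z - w) = q z w * norm (z - cnj w)"
      using norm_diff_less_norm_diff_cnj[OF that] by (simp_all add: q_def)
  qed
  define r where "r = max (1/2) (max (q z1 w1) (q z2 w2))"
  have "norm (G (z1, z2) - G (w1, w2)) \<le> 2 * r / (1 - r) * Im (G (w1, w2))"
  proof (rule Harnack_inequality[OF G z w])
    show "norm (z1 - w1) \<le> r * norm (z1 - cnj w1)" "norm (z2 - w2) \<le> r * norm (z2 - cnj w2)"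
      using q(2)[OF z(1) w(1)] q(2)[OF z(2) w(2)] by (auto simp: r_def intro!: mult_right_mono)
    show "0 < r" "r < 1" using q(1)[OF z(1) w(1)] q(1)[OF z(2) w(2)] by (auto simp: r_def)
  qed
  with 0 show ?thesis by simp
qed

section \<open>Boundary behaviour of Pick functions\<close>

lemma cnj_eq_self: "Im x = 0 \<Longrightarrow> cnj x = x"
  by (simp add: complex_eq_iff)

text \<open>The hypothesis is a one-variable boundary derivative on the slice \<open>z2 = z0\<close>, the conclusion
  holds at all points: it bounds \<open>Im (- 1 / H)\<close> below by \<open>Im (- 1 / (\<beta> (z1 - x)))\<close>, with
  denominators cleared. Squaring the Schwarz--Pick inequality between \<open>z\<close> and \<open>(x + \<i> y, z0)\<close>
  gives an inequality with a factor \<open>y\<close> on the left and \<open>Im (H (x + \<i> y, z0))\<close> on the right; divide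
  by \<open>y\<close> and let \<open>y\<close> tend to \<open>0\<close>.\<close>

lemma Julia_inequality:
  assumes H: "H \<in> pick_class2" and x: "Im x = 0" and z0: "Im z0 > 0"
    and lim: "((\<lambda>y::real. H (x + \<i> * of_real y, z0) / (\<i> * of_real y)) \<longlongrightarrow> of_real \<beta>) (at_right 0)"
    and z: "Im z1 > 0" "Im z2 > 0"
  shows "Im z1 * (norm (H (z1, z2)))\<^sup>2 \<le> \<beta> * Im (H (z1, z2)) * (norm (z1 - x))\<^sup>2"
proof -
  define w where "w y = x + \<i> * of_real y" for y :: real
  define b where "b y = H (w y, z0)" for y
  define a where "a = H (z1, z2)"
  define r where "r y = norm (z1 - w y) / norm (z1 - cnj (w y))" for y
  have Im_w: "Im (w y) = y" for y using x by (simp add: w_def)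
  have pos: "\<forall>\<^sub>F y::real in at_right 0. y > 0" by (rule eventually_at_right_less)
  have w_lim: "(w \<longlongrightarrow> x) (at_right 0)"
    unfolding w_def by (auto intro!: tendsto_eq_intros)
  have w_lim': "((\<lambda>y. cnj (w y)) \<longlongrightarrow> x) (at_right 0)"
    using tendsto_cnj[OF w_lim] x by (simp add: cnj_eq_self)
  have q_lim: "((\<lambda>y. b y / (\<i> * of_real y)) \<longlongrightarrow> of_real \<beta>) (at_right 0)"
    using lim by (simp add: b_def w_def)
  have "((\<lambda>y. b y / (\<i> * of_real y) * (\<i> * of_real y)) \<longlongrightarrow> of_real \<beta> * (\<i> * of_real 0)) (at_right 0)"
    by (intro tendsto_mult q_lim tendsto_const tendsto_of_real tendsto_ident_at)
  moreover have "\<forall>\<^sub>F y in at_right 0. b y / (\<i> * of_real y) * (\<i> * of_real y) = b y"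
    using pos by eventually_elim simp
  ultimately have "(b \<longlongrightarrow> of_real \<beta> * (\<i> * of_real 0)) (at_right 0)"
    by (rule Lim_transform_eventually)
  then have b_lim: "(b \<longlongrightarrow> 0) (at_right 0)" by simp
  have Im_b_lim: "((\<lambda>y. Im (b y) / y) \<longlongrightarrow> \<beta>) (at_right 0)"
  proof -
    have "Re (c / (\<i> * of_real y)) = Im c / y" for c y
      by (simp add: Re_divide power2_eq_square)
    with tendsto_Re[OF q_lim] show ?thesis by simp
  qed
  have z1x: "norm (z1 - x) > 0" using z x by auto
  have "(r \<longlongrightarrow> norm (z1 - x) / norm (z1 - x)) (at_right 0)"
    unfolding r_def using z1x by (intro tendsto_intros w_lim w_lim') auto
  then have r_lim: "(r \<longlongrightarrow> 1) (at_right 0)" using z1x by simp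
  \<comment> \<open>As \<open>y\<close> tends to \<open>0\<close> the first coordinates move infinitely far apart, so the second
    ones no longer influence the maximum of the two distances.\<close>
  define \<rho> where "\<rho> = norm (z2 - z0) / norm (z2 - cnj z0)"
  have "norm (z2 - cnj z0) > 0" "\<rho> < 1"
    using norm_diff_less_norm_diff_cnj[OF z(2) z0] norm_ge_zero[of "z2 - z0"]
    by (auto simp: \<rho>_def divide_simps simp del: norm_ge_zero)
  have "\<forall>\<^sub>F y in at_right 0. max 0 \<rho> < r y"
    using r_lim \<open>\<rho> < 1\<close> by (intro order_tendstoD(1)) auto
  then have ineq: "\<forall>\<^sub>F y in at_right 0.
      Im z1 * (norm (a - cnj (b y)))\<^sup>2 \<le> Im a * (Im (b y) / y) * (norm (z1 - cnj (w y)))\<^sup>2"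
    using pos
  proof eventually_elim
    case (elim y)
    have Iw: "Im (w y) > 0" using Im_w elim by simp
    have lt: "norm (z1 - w y) < norm (z1 - cnj (w y))"
      by (rule norm_diff_less_norm_diff_cnj[OF z(1) Iw])
    then have N: "norm (z1 - cnj (w y)) > 0" using norm_ge_zero[of "z1 - w y"] by linarith
    have r_eq: "norm (z1 - w y) = r y * norm (z1 - cnj (w y))" using N by (simp add: r_def)
    have "norm (z2 - z0) = \<rho> * norm (z2 - cnj z0)"
      using \<open>norm (z2 - cnj z0) > 0\<close> by (simp add: \<rho>_def)
    then have z2_le: "norm (z2 - z0) \<le> r y * norm (z2 - cnj z0)"
      using elim mult_right_mono[of \<rho> "r y" "norm (z2 - cnj z0)"] by simp
    have "norm (a - b y) \<le> r y * norm (a - cnj (b y))"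
      unfolding a_def b_def
    proof (intro Schwarz_Pick[OF H z Iw z0])
      show "norm (z1 - w y) \<le> r y * norm (z1 - cnj (w y))" using r_eq by simp
      show "r y < 1" using lt N by (simp add: r_def)
    qed (use elim z2_le in auto)
    then have "norm (a - b y) * norm (z1 - cnj (w y)) \<le>
        r y * norm (a - cnj (b y)) * norm (z1 - cnj (w y))"
      by (rule mult_right_mono) simp
    also have "\<dots> = norm (z1 - w y) * norm (a - cnj (b y))"
      unfolding r_eq by (simp only: mult_ac)
    finally have "norm (a - b y) * norm (z1 - cnj (w y)) \<le> norm (z1 - w y) * norm (a - cnj (b y))" .
    then have "(norm (a - b y))\<^sup>2 * (norm (z1 - cnj (w y)))\<^sup>2
        \<le> (norm (z1 - w y))\<^sup>2 * (norm (a - cnj (b y)))\<^sup>2"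
      unfolding power_mult_distrib[symmetric] by (rule power_mono) simp
    then have "Im z1 * y * (norm (a - cnj (b y)))\<^sup>2 \<le> Im a * Im (b y) * (norm (z1 - cnj (w y)))\<^sup>2"
      unfolding norm_diff_square_eq_norm_diff_cnj_square[of a "b y"]
        norm_diff_square_eq_norm_diff_cnj_square[of z1 "w y"] Im_w
      by (simp add: algebra_simps)
    then show ?case using elim by (simp add: field_simps)
  qed
  have L: "((\<lambda>y. Im z1 * (norm (a - cnj (b y)))\<^sup>2) \<longlongrightarrow> Im z1 * (norm (a - cnj 0))\<^sup>2) (at_right 0)"
    by (intro tendsto_intros b_lim)
  have R: "((\<lambda>y. Im a * (Im (b y) / y) * (norm (z1 - cnj (w y)))\<^sup>2) \<longlongrightarrow>
      Im a * \<beta> * (norm (z1 - x))\<^sup>2) (at_right 0)"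
    by (intro tendsto_intros Im_b_lim w_lim')
  have "Im z1 * (norm (a - cnj 0))\<^sup>2 \<le> Im a * \<beta> * (norm (z1 - x))\<^sup>2"
    by (rule tendsto_le[OF _ R L ineq]) simp
  then show ?thesis by (simp add: a_def mult.commute)
qed

text \<open>The comparison point for \<open>(z1, z2)\<close> is \<open>(x + \<i> y, z0)\<close> with \<open>y = norm (z1 - x)\<close>. Since \<open>z1\<close> stays
  in a sector at \<open>x\<close> and \<open>z2\<close> is close to \<open>z0\<close>, the Harnack inequality applies with a fixed \<open>r < 1\<close>,
  so decay above \<open>x\<close> carries over.\<close>

lemma nontangentially_negligible:
  assumes G: "G \<in> pick_class2" and x: "Im x = 0" and z0: "Im z0 > 0"
    and lim: "((\<lambda>y::real. of_real y * G (x + \<i> * of_real y, z0)) \<longlongrightarrow> 0) (at_right 0)"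
    and K: "K \<ge> 1"
    and ev: "\<forall>\<^sub>F t in F. Im (z1 t) > 0 \<and> Im (z2 t) > 0 \<and> norm (z1 t - x) \<le> K * Im (z1 t)"
    and z1: "(z1 \<longlongrightarrow> x) F" and z2: "(z2 \<longlongrightarrow> z0) F"
  shows "((\<lambda>t. (z1 t - x) * G (z1 t, z2 t)) \<longlongrightarrow> 0) F"
proof -
  define y where "y t = norm (z1 t - x)" for t
  define w where "w t = G (x + \<i> * of_real (y t), z0)" for t
  define r where "r = max (1/2) (sqrt (1 - 1/K))"
  have r: "0 < r" "r < 1" using K by (auto simp: r_def)
  define k where "k = 2 * r / (1 - r)"
  have k: "k \<ge> 0" using r by (simp add: k_def)
  have "0 \<le> 1 - 1/K" using K by simp
  then have r_sq: "1 - 1/K \<le> r\<^sup>2"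
    using power_mono[of "sqrt (1 - 1/K)" r 2] by (simp add: r_def)
  have y_pos: "\<forall>\<^sub>F t in F. y t > 0"
    using ev by eventually_elim (use x in \<open>auto simp: y_def\<close>)
  have y_lim: "(y \<longlongrightarrow> 0) F"
    unfolding y_def using tendsto_norm[OF tendsto_diff[OF z1 tendsto_const[of x]]] by simp
  have "filterlim y (at_right 0) F"
    using y_lim y_pos by (auto simp: filterlim_at elim: eventually_mono)
  from filterlim_compose[OF lim this]
  have yw: "((\<lambda>t. of_real (y t) * w t) \<longlongrightarrow> 0) F" by (simp add: w_def)
  have "((\<lambda>t. norm (z2 t - z0)) \<longlongrightarrow> 0) F"
    using tendsto_norm[OF tendsto_diff[OF z2 tendsto_const[of z0]]] by simp
  then have "\<forall>\<^sub>F t in F. norm (z2 t - z0) < Im z0 / 2"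
    using z0 by (intro order_tendstoD(2)) auto
  then have "\<forall>\<^sub>F t in F. norm ((z1 t - x) * G (z1 t, z2 t)) \<le>
      norm (of_real (y t) * w t) * (1 + k)"
    using ev y_pos
  proof eventually_elim
    case (elim t)
    let ?w1 = "x + \<i> * of_real (y t)"
    have Iw: "Im ?w1 = y t" "cnj ?w1 = x - \<i> * of_real (y t)"
      using x by (simp_all add: cnj_eq_self)
    \<comment> \<open>Both \<open>z1 t\<close> and the point \<open>?w1\<close> above \<open>x\<close> lie at distance \<open>y t\<close> from \<open>x\<close>, within
      a sector; so their hyperbolic distance is bounded.\<close>
    have "norm (z1 t - cnj ?w1) \<le> norm (z1 t - x) + norm (\<i> * of_real (y t))"
      unfolding Iw diff_diff_eq2 diff_add_eq[symmetric] by (rule norm_triangle_ineq)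
    then have "norm (z1 t - cnj ?w1) \<le> 2 * y t"
      using elim by (simp add: y_def norm_mult)
    then have "(norm (z1 t - cnj ?w1))\<^sup>2 \<le> (2 * y t)\<^sup>2" by (rule power_mono) simp
    also have "\<dots> = 4 * y t * y t" by (simp add: power2_eq_square)
    also have "\<dots> \<le> 4 * y t * (K * Im (z1 t))"
      using elim by (intro mult_left_mono) (auto simp: y_def)
    finally have "(norm (z1 t - cnj ?w1))\<^sup>2 / K \<le> 4 * Im (z1 t) * y t"
      using K by (simp add: field_simps)
    then have "(norm (z1 t - ?w1))\<^sup>2 \<le> (1 - 1/K) * (norm (z1 t - cnj ?w1))\<^sup>2"
      using norm_diff_square_eq_norm_diff_cnj_square[of "z1 t" ?w1] unfolding Iw(1)
      by (simp add: algebra_simps)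
    also have "\<dots> \<le> r\<^sup>2 * (norm (z1 t - cnj ?w1))\<^sup>2"
      using r_sq by (intro mult_right_mono) auto
    finally have 1: "norm (z1 t - ?w1) \<le> r * norm (z1 t - cnj ?w1)"
      using r unfolding power_mult_distrib[symmetric]
      by (meson less_imp_le mult_nonneg_nonneg norm_ge_zero power2_le_imp_le)
    have "Im z0 \<le> norm (z2 t - cnj z0)"
      using abs_Im_le_cmod[of "z2 t - cnj z0"] elim z0 by simp
    then have "norm (z2 t - z0) \<le> 1/2 * norm (z2 t - cnj z0)" using elim by simp
    also have "\<dots> \<le> r * norm (z2 t - cnj z0)" by (intro mult_right_mono) (auto simp: r_def)
    finally have 2: "norm (z2 t - z0) \<le> r * norm (z2 t - cnj z0)" .
    have "norm (G (z1 t, z2 t) - w t) \<le> k * Im (w t)"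
      unfolding w_def k_def using elim Iw z0 1 2 r by (intro Harnack_inequality[OF G]) auto
    also have "\<dots> \<le> k * norm (w t)"
      using k abs_Im_le_cmod[of "w t"] by (intro mult_left_mono) auto
    finally have "norm (G (z1 t, z2 t)) \<le> norm (w t) * (1 + k)"
      using norm_triangle_ineq2[of "G (z1 t, z2 t)" "w t"] by (simp add: algebra_simps)
    then have "y t * norm (G (z1 t, z2 t)) \<le> y t * (norm (w t) * (1 + k))"
      using elim by (intro mult_left_mono) auto
    then show ?case
      using elim by (simp add: norm_mult y_def mult.assoc)
  qed
  then show ?thesis by (rule tendsto_0_le[OF yw])
qed

section \<open>Nontangential approach in the bidisc\<close>

lemma norm_coordinate_le_max_norm: "norm (fst p) \<le> max_norm p" "norm (snd p) \<le> max_norm p"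
  by (auto simp: max_norm_def)

lemma max_norm_diff_ge: "max_norm m - max_norm l \<le> max_norm (l - m)"
  using norm_triangle_ineq2[of "fst m" "fst l"] norm_triangle_ineq2[of "snd m" "snd l"]
  by (auto simp: max_norm_def norm_minus_commute max_def)

lemma mem_bidisc_iff_max_norm: "l \<in> bidisc \<longleftrightarrow> max_norm l < 1"
  by (cases l) (auto simp: mem_bidisc_iff max_norm_def)

lemma max_setdist_bidisc:
  assumes "l \<in> bidisc"
  shows "max_setdist l (- bidisc) = 1 - max_norm l"
proof (rule antisym)
  have lower: "1 - max_norm l \<le> max_norm (l - m)" if "m \<in> - bidisc" for m
    using that max_norm_diff_ge[of m l] by (auto simp: mem_bidisc_iff_max_norm)
  have polar: "\<exists>e. norm e = 1 \<and> norm (c - e) = 1 - norm c" if "norm c \<le> 1" for c :: complex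
  proof -
    have "\<exists>e. norm e = 1 \<and> c = of_real (norm c) * e"
    proof (cases "c = 0")
      case True
      then show ?thesis by (intro exI[of _ 1]) simp
    next
      case False
      then show ?thesis by (intro exI[of _ "c / of_real (norm c)"]) (simp add: norm_divide)
    qed
    then obtain e where e: "norm e = 1" "c = of_real (norm c) * e" by blast
    have "c - e = of_real (norm c - 1) * e"
      using e(2) by (metis left_diff_distrib mult_1 of_real_1 of_real_diff)
    then have "norm (c - e) = \<bar>norm c - 1\<bar> * norm e"
      by (metis norm_mult norm_of_real)
    then have "norm (c - e) = 1 - norm c" using e(1) that by simp
    with e(1) show ?thesis by blast
  qed
  obtain a b where l: "l = (a, b)" by (cases l)
  have "norm a < 1" "norm b < 1" using assms by (auto simp: l mem_bidisc_iff)
  then obtain e f where e: "norm e = 1" "norm (a - e) = 1 - norm a"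
    and f: "norm f = 1" "norm (b - f) = 1 - norm b"
    using polar[of a] polar[of b] by auto
  \<comment> \<open>A nearest point of the complement: push the larger coordinate radially to the circle.\<close>
  have "\<exists>m\<in>- bidisc. max_norm (l - m) = 1 - max_norm l"
  proof (cases "norm b \<le> norm a")
    case True
    then show ?thesis
      using e \<open>norm a < 1\<close> by (intro bexI[of _ "(e, b)"]) (auto simp: l max_norm_def mem_bidisc_iff)
  next
    case False
    then show ?thesis
      using f \<open>norm b < 1\<close> by (intro bexI[of _ "(a, f)"]) (auto simp: l max_norm_def mem_bidisc_iff)
  qed
  then obtain m where m: "m \<in> - bidisc" "max_norm (l - m) = 1 - max_norm l" by blast
  show "max_setdist l (- bidisc) \<le> 1 - max_norm l"
    unfolding max_setdist_def m(2)[symmetric]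
    by (rule cINF_lower[OF _ m(1)]) (use lower in \<open>auto intro!: bdd_belowI2\<close>)
  show "1 - max_norm l \<le> max_setdist l (- bidisc)"
    unfolding max_setdist_def by (rule cINF_greatest) (use m lower in auto)
qed

text \<open>By \<open>max_setdist_bidisc\<close> the distance to the complement in the definition of nontangential
  approach is \<open>1 - max_norm l\<close>.\<close>

lemma approaches_nontangentiallyI:
  assumes S: "S \<subseteq> bidisc" and cl: "\<tau> \<in> closure S" and \<tau>: "\<tau> \<notin> bidisc"
    and K: "\<And>l. l \<in> S \<Longrightarrow> max_norm (l - \<tau>) \<le> K * (1 - max_norm l)"
  shows "approaches_nontangentially S \<tau>"
  unfolding approaches_nontangentially_def
proof (intro conjI S cl)
  show "\<tau> \<in> frontier bidisc"
    using closure_mono[OF S] cl \<tau> interior_open[OF open_bidisc] by (auto simp: frontier_def)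
  show "bounded ((\<lambda>l. max_norm (l - \<tau>) / max_setdist l (- bidisc)) ` S)"
    unfolding bounded_iff
  proof (intro exI ballI)
    fix q assume "q \<in> (\<lambda>l. max_norm (l - \<tau>) / max_setdist l (- bidisc)) ` S"
    then obtain l where l: "l \<in> S" and q: "q = max_norm (l - \<tau>) / max_setdist l (- bidisc)"
      by blast
    have "max_norm l < 1" using l S mem_bidisc_iff_max_norm by blast
    moreover have "max_norm (l - \<tau>) \<ge> 0" by (simp add: max_norm_def le_max_iff_disj)
    ultimately show "norm q \<le> K"
      using K[OF l] l S by (auto simp: q max_setdist_bidisc divide_simps)
  qed
qed

lemma approaches_nontangentiallyE:
  assumes S: "approaches_nontangentially S \<tau>"
  obtains K where "K \<ge> 1" "\<And>l. l \<in> S \<Longrightarrow> max_norm (l - \<tau>) \<le> K * (1 - max_norm l)"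
proof -
  have sub: "S \<subseteq> bidisc" using S by (simp add: approaches_nontangentially_def)
  obtain K where K: "\<And>l. l \<in> S \<Longrightarrow> \<bar>max_norm (l - \<tau>) / max_setdist l (- bidisc)\<bar> \<le> K"
    using S unfolding approaches_nontangentially_def bounded_iff by auto
  show ?thesis
  proof (rule that[of "max 1 K"])
    fix l assume l: "l \<in> S"
    then have "max_norm l < 1" using sub mem_bidisc_iff_max_norm by blast
    moreover have "max_setdist l (- bidisc) = 1 - max_norm l"
      using l sub by (intro max_setdist_bidisc) auto
    then have "max_norm (l - \<tau>) / (1 - max_norm l) \<le> max 1 K"
      using abs_le_D1[OF K[OF l]] by simp
    ultimately show "max_norm (l - \<tau>) \<le> max 1 K * (1 - max_norm l)"
      by (simp add: divide_simps)
  qed simp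
qed

lemma approaches_nontangentially_not_bot:
  assumes "approaches_nontangentially S \<tau>"
  shows "at \<tau> within S \<noteq> bot"
proof -
  have "\<tau> \<in> closure S" "\<tau> \<notin> S"
    using assms interior_open[OF open_bidisc]
    by (auto simp: approaches_nontangentially_def frontier_def)
  then show ?thesis by (simp add: closure_def islimpt_def trivial_limit_within)
qed

lemma eventually_mem_within: "\<forall>\<^sub>F l in at \<tau> within S. l \<in> S"
  by (simp add: eventually_at_filter)

lemma tendsto_coordinates_within:
  "(fst \<longlongrightarrow> fst \<tau>) (at \<tau> within S)" "(snd \<longlongrightarrow> snd \<tau>) (at \<tau> within S)"
  by (auto intro!: tendsto_intros)

text \<open>It suffices to bound the difference quotient along a single approach set, because a lower
  limit can only grow when the filter is restricted. On a nontangential set \<open>max_norm (l - \<tau>)\<close>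
  is comparable to \<open>1 - max_norm l\<close>, and \<open>1 - norm (\<phi> l)\<close> is at most \<open>norm (\<phi> l - w)\<close>.\<close>

lemma B_pointI:
  assumes S: "approaches_nontangentially S \<tau>" and w: "norm w = 1"
    and C: "\<forall>\<^sub>F l in at \<tau> within S. norm (\<phi> l - w) \<le> C * max_norm (l - \<tau>)"
  shows "B_point \<phi> \<tau>"
proof -
  obtain K where K: "K \<ge> 1" "\<And>l. l \<in> S \<Longrightarrow> max_norm (l - \<tau>) \<le> K * (1 - max_norm l)"
    using approaches_nontangentiallyE[OF S] by blast
  have sub: "S \<subseteq> bidisc" and fr: "\<tau> \<in> frontier bidisc"
    using S by (auto simp: approaches_nontangentially_def)
  let ?f = "\<lambda>l. ereal ((1 - norm (\<phi> l)) / (1 - max_norm l))"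
  have le: "\<forall>\<^sub>F l in at \<tau> within S. ?f l \<le> ereal (\<bar>C\<bar> * K)"
    using C eventually_mem_within
  proof eventually_elim
    case (elim l)
    have pos: "max_norm l < 1" using elim sub mem_bidisc_iff_max_norm by blast
    have "1 - norm (\<phi> l) \<le> norm (\<phi> l - w)"
      using norm_triangle_ineq3[of "\<phi> l" w] w by linarith
    also have "\<dots> \<le> \<bar>C\<bar> * max_norm (l - \<tau>)"
    proof -
      have "0 \<le> max_norm (l - \<tau>)" by (simp add: max_norm_def le_max_iff_disj)
      then show ?thesis
        using elim(1) mult_right_mono[of C "\<bar>C\<bar>" "max_norm (l - \<tau>)"] by linarith
    qed
    also have "\<dots> \<le> \<bar>C\<bar> * (K * (1 - max_norm l))"
      by (intro mult_left_mono K elim) simp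
    finally show ?case using pos by (simp add: divide_simps mult.assoc)
  qed
  have "Liminf (at \<tau> within bidisc) ?f \<le> Liminf (at \<tau> within S) ?f"
    unfolding Liminf_def by (rule SUP_subset_mono) (auto dest: filter_leD[OF at_le[OF sub]])
  also have "\<dots> \<le> Limsup (at \<tau> within S) ?f"
    by (rule Liminf_le_Limsup[OF approaches_nontangentially_not_bot[OF S]])
  also have "\<dots> \<le> ereal (\<bar>C\<bar> * K)" by (rule Limsup_bounded[OF le])
  finally show ?thesis using fr by (auto simp: B_point_def)
qed

lemma first_order_expansion_imp_tendsto:
  assumes "first_order_expansion \<phi> \<tau> S w \<eta>"
  shows "(\<phi> \<longlongrightarrow> w) (at \<tau> within S)"
proof -
  define A where "A l = w + fst \<eta> * (fst l - fst \<tau>) + snd \<eta> * (snd l - snd \<tau>)" for l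
  define e where "e l = (\<phi> l - A l) / of_real (max_norm (l - \<tau>))" for l
  have e: "(e \<longlongrightarrow> 0) (at \<tau> within S)"
    using assms by (simp add: first_order_expansion_def e_def[abs_def] A_def)
  have "((\<lambda>l. max_norm (l - \<tau>)) \<longlongrightarrow> max (norm (fst \<tau> - fst \<tau>)) (norm (snd \<tau> - snd \<tau>))) (at \<tau> within S)"
    unfolding max_norm_def fst_diff snd_diff
    by (intro tendsto_max tendsto_norm tendsto_diff tendsto_const tendsto_coordinates_within)
  then have m: "((\<lambda>l. max_norm (l - \<tau>)) \<longlongrightarrow> 0) (at \<tau> within S)" by simp
  have A: "(A \<longlongrightarrow> w + fst \<eta> * (fst \<tau> - fst \<tau>) + snd \<eta> * (snd \<tau> - snd \<tau>)) (at \<tau> within S)"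
    unfolding A_def[abs_def] by (intro tendsto_intros)
  have "((\<lambda>l. e l * of_real (max_norm (l - \<tau>)) + A l) \<longlongrightarrow> w) (at \<tau> within S)"
    using tendsto_add[OF tendsto_mult[OF e tendsto_of_real[OF m]] A] by simp
  moreover have "\<forall>\<^sub>F l in at \<tau> within S. e l * of_real (max_norm (l - \<tau>)) + A l = \<phi> l"
    unfolding eventually_at_filter
  proof (intro always_eventually allI impI)
    fix l assume "l \<noteq> \<tau>"
    then have "max_norm (l - \<tau>) \<noteq> 0"
      by (auto simp: max_norm_def prod_eq_iff max_def)
    then show "e l * of_real (max_norm (l - \<tau>)) + A l = \<phi> l" by (simp add: e_def)
  qed
  ultimately show ?thesis by (rule Lim_transform_eventually)
qed

text \<open>When the second component of the gradient is \<open>0\<close>, the expansion only needs the difference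
  quotient in the first coordinate, since \<open>norm (fst l - fst \<tau>)\<close> is at most \<open>max_norm (l - \<tau>)\<close>.\<close>

lemma first_order_expansion_if_quotient_tendsto:
  assumes q: "((\<lambda>l. (\<phi> l - w) / (fst l - fst \<tau>)) \<longlongrightarrow> a) (at \<tau> within S)"
    and S: "\<And>l. l \<in> S \<Longrightarrow> fst l \<noteq> fst \<tau>"
  shows "first_order_expansion \<phi> \<tau> S w (a, 0)"
  unfolding first_order_expansion_def
proof (rule Lim_null_comparison)
  show "((\<lambda>l. norm ((\<phi> l - w) / (fst l - fst \<tau>) - a)) \<longlongrightarrow> 0) (at \<tau> within S)"
    using tendsto_norm[OF tendsto_diff[OF q tendsto_const[of a]]] by simp
  show "\<forall>\<^sub>F l in at \<tau> within S.
      norm ((\<phi> l - (w + fst (a, 0) * (fst l - fst \<tau>) + snd (a, 0) * (snd l - snd \<tau>))) /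
        of_real (max_norm (l - \<tau>))) \<le> norm ((\<phi> l - w) / (fst l - fst \<tau>) - a)"
    using eventually_mem_within
  proof eventually_elim
    case (elim l)
    let ?d = "fst l - fst \<tau>"
    have d: "?d \<noteq> 0" using S[OF elim] by simp
    have le: "norm ?d \<le> max_norm (l - \<tau>)" using norm_coordinate_le_max_norm(1)[of "l - \<tau>"] by simp
    then have pos: "0 < max_norm (l - \<tau>)" using d by (meson less_le_trans zero_less_norm_iff)
    have "\<phi> l - (w + a * ?d) = ((\<phi> l - w) / ?d - a) * ?d" using d by (simp add: field_simps)
    then have "norm (\<phi> l - (w + a * ?d)) \<le> norm ((\<phi> l - w) / ?d - a) * max_norm (l - \<tau>)"
      using mult_left_mono[OF le norm_ge_zero] by (simp add: norm_mult)
    then show ?case using pos by (simp add: norm_divide divide_simps)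
  qed
qed

section \<open>Cayley transforms\<close>

definition half_plane_to_disc :: "complex \<Rightarrow> complex" where
  "half_plane_to_disc z = (z - \<i>) / (z + \<i>)"

lemma neq_minus_i: "Im z \<ge> 0 \<Longrightarrow> z \<noteq> - \<i>"
  by auto

lemma Im_one_divide: "Im (1 / v) = - Im v / (norm v)\<^sup>2"
  by (simp add: Im_divide cmod_power2)

lemma disc_to_half_plane_diff:
  assumes "a \<noteq> 1" "b \<noteq> 1"
  shows "disc_to_half_plane a - disc_to_half_plane b = 2 * \<i> * (a - b) / ((1 - a) * (1 - b))"
  using assms by (simp add: disc_to_half_plane_def divide_simps) (simp add: algebra_simps)

lemma Im_disc_to_half_plane:
  assumes "l \<noteq> 1"
  shows "Im (disc_to_half_plane l) = (1 - (norm l)\<^sup>2) / (norm (1 - l))\<^sup>2"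
proof -
  have "Im (disc_to_half_plane l) = Re ((1 + l) / (1 - l))"
    by (simp add: disc_to_half_plane_def del: times_divide_eq_right)
  also have "\<dots> = (1 - (norm l)\<^sup>2) / (norm (1 - l))\<^sup>2"
    unfolding Re_divide cmod_power2
    by (rule arg_cong2[where f = "(/)"]) (simp_all add: power2_eq_square algebra_simps)
  finally show ?thesis .
qed

lemma Im_disc_to_half_plane_pos: "norm l < 1 \<Longrightarrow> Im (disc_to_half_plane l) > 0"
  by (subst Im_disc_to_half_plane) (auto simp: abs_square_less_1 intro!: divide_pos_pos)

lemma Im_disc_to_half_plane_eq_0: "norm l = 1 \<Longrightarrow> Im (disc_to_half_plane l) = 0"
  using Im_disc_to_half_plane[of l] by (cases "l = 1") (simp_all add: disc_to_half_plane_def)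

lemma disc_to_half_plane_neq_minus_i: "disc_to_half_plane l \<noteq> - \<i>"
proof
  assume "disc_to_half_plane l = - \<i>"
  then have "\<i> * ((1 + l) / (1 - l)) = \<i> * (- 1)"
    unfolding disc_to_half_plane_def mult_minus_right mult_1_right .
  then have eq: "(1 + l) / (1 - l) = - 1"
    using mult_left_cancel[OF complex_i_not_zero] by blast
  then have "1 - l \<noteq> 0" by auto
  with eq have "1 + l = - (1 - l)" by (simp add: divide_eq_eq)
  then show False by simp
qed

lemma half_plane_to_disc_inverse: "l \<noteq> 1 \<Longrightarrow> half_plane_to_disc (disc_to_half_plane l) = l"
  using disc_to_half_plane_neq_minus_i[of l]
  unfolding half_plane_to_disc_def disc_to_half_plane_def
  by (simp add: divide_simps add_eq_0_iff) (simp add: algebra_simps)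

lemma disc_to_half_plane_inverse:
  assumes "z \<noteq> - \<i>" shows "disc_to_half_plane (half_plane_to_disc z) = z"
proof -
  have "z + \<i> \<noteq> 0" using assms by (simp add: add_eq_0_iff2)
  then have "1 + half_plane_to_disc z = 2 * z / (z + \<i>)" "1 - half_plane_to_disc z = 2 * \<i> / (z + \<i>)"
    by (simp_all add: half_plane_to_disc_def field_simps)
  with \<open>z + \<i> \<noteq> 0\<close> show ?thesis by (simp add: disc_to_half_plane_def)
qed

lemma norm_half_plane_to_disc_less_1: "Im z > 0 \<Longrightarrow> norm (half_plane_to_disc z) < 1"
  using norm_diff_less_norm_diff_cnj[of z \<i>]
  by (auto simp: half_plane_to_disc_def norm_divide divide_simps)

text \<open>The factor \<open>2\<close> is half of the \<open>4\<close> in the exact formula for \<open>1 - (norm l)\<^sup>2\<close>, lost by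
  estimating \<open>1 + norm l\<close> by \<open>2\<close>.\<close>

lemma one_minus_norm_half_plane_to_disc:
  assumes "Im z > 0"
  shows "2 * Im z / (norm (z + \<i>))\<^sup>2 \<le> 1 - norm (half_plane_to_disc z)"
proof -
  let ?l = "half_plane_to_disc z"
  have l: "norm ?l < 1" by (rule norm_half_plane_to_disc_less_1[OF assms])
  have "z + \<i> \<noteq> 0" using assms by (auto simp: complex_eq_iff)
  have "(norm ?l)\<^sup>2 = (norm (z - \<i>))\<^sup>2 / (norm (z + \<i>))\<^sup>2"
    by (simp add: half_plane_to_disc_def norm_divide power_divide)
  also have "(norm (z - \<i>))\<^sup>2 = (norm (z + \<i>))\<^sup>2 - 4 * Im z"
    using norm_diff_square_eq_norm_diff_cnj_square[of z \<i>] by simp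
  finally have "4 * Im z / (norm (z + \<i>))\<^sup>2 = 1 - (norm ?l)\<^sup>2"
    using \<open>z + \<i> \<noteq> 0\<close> by (simp add: field_simps)
  also have "\<dots> = (1 + norm ?l) * (1 - norm ?l)"
    by (simp add: power2_eq_square algebra_simps)
  also have "\<dots> \<le> 2 * (1 - norm ?l)" using l by (intro mult_right_mono) auto
  finally show ?thesis by simp
qed

lemma holomorphic_disc_to_half_plane: "disc_to_half_plane holomorphic_on - {1}"
  unfolding disc_to_half_plane_def by (intro holomorphic_intros) auto

lemma holomorphic_half_plane_to_disc: "half_plane_to_disc holomorphic_on - {- \<i>}"
  unfolding half_plane_to_disc_def by (intro holomorphic_intros) (auto simp: add_eq_0_iff2)

lemma half_plane_to_disc_diff:
  assumes "z \<noteq> - \<i>" "w \<noteq> - \<i>"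
  shows "half_plane_to_disc z - half_plane_to_disc w = 2 * \<i> * (z - w) / ((z + \<i>) * (w + \<i>))"
  using assms unfolding half_plane_to_disc_def add_eq_0_iff[symmetric]
  by (simp add: divide_simps add.commute) (simp add: algebra_simps)

text \<open>This converts difference quotients of \<open>\<phi>\<close> at a boundary point into difference quotients of its
  transform to the half-plane; in the limit the last factor becomes the ratio of the
  derivatives of the Cayley transforms.\<close>

lemma disc_to_half_plane_quotient:
  assumes "p \<noteq> 1" "q \<noteq> 1" "l \<noteq> 1" "t \<noteq> 1"
  shows "(disc_to_half_plane p - disc_to_half_plane q) / (disc_to_half_plane l - disc_to_half_plane t)
    = (p - q) / (l - t) * ((1 - l) * (1 - t) / ((1 - p) * (1 - q)))"
  using assms by (simp add: disc_to_half_plane_diff)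

lemma disc_quotient:
  assumes "p \<noteq> 1" "q \<noteq> 1" "l \<noteq> 1" "t \<noteq> 1"
  shows "(p - q) / (l - t)
    = (disc_to_half_plane p - disc_to_half_plane q) / (disc_to_half_plane l - disc_to_half_plane t)
      * ((1 - p) * (1 - q) / ((1 - l) * (1 - t)))"
proof -
  have "a = a * (B / C) * (C / B)" if "B \<noteq> 0" "C \<noteq> 0" for a B C :: complex using that by simp
  then show ?thesis unfolding disc_to_half_plane_quotient[OF assms] using assms by simp
qed

text \<open>The Cayley transform carries a nontangential region of the disc at \<open>\<tau>\<close> into a sector of the
  half-plane at the image of \<open>\<tau>\<close>.\<close>

lemma nontangential_in_half_plane:
  assumes \<tau>: "norm \<tau> = 1" "\<tau> \<noteq> 1" and l: "norm l < 1" and K: "norm (l - \<tau>) \<le> K * (1 - norm l)"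
  shows "norm (disc_to_half_plane l - disc_to_half_plane \<tau>)
    \<le> 4 * K / norm (1 - \<tau>) * Im (disc_to_half_plane l)"
proof -
  have l1: "l \<noteq> 1" using l by auto
  then have pos: "norm (1 - l) > 0" "norm (1 - \<tau>) > 0" using \<tau> by auto
  have "0 \<le> K * (1 - norm l)" using K norm_ge_zero[of "l - \<tau>"] by linarith
  then have "K \<ge> 0" using l by (simp add: zero_le_mult_iff)
  have "norm (1 - l) \<le> 2" using norm_triangle_ineq4[of 1 l] l by simp
  have sq: "1 - norm l \<le> 1 - (norm l)\<^sup>2"
    using l by (simp add: power2_eq_square mult_left_le)
  have "norm (disc_to_half_plane l - disc_to_half_plane \<tau>) =
      2 * norm (l - \<tau>) / (norm (1 - l) * norm (1 - \<tau>))"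
    using l1 \<tau> by (simp add: disc_to_half_plane_diff norm_divide norm_mult)
  also have "\<dots> = 2 * norm (l - \<tau>) * norm (1 - l) / (norm (1 - \<tau>) * (norm (1 - l))\<^sup>2)"
    using pos by (simp add: power2_eq_square)
  also have "\<dots> \<le> 2 * (K * (1 - (norm l)\<^sup>2)) * 2 / (norm (1 - \<tau>) * (norm (1 - l))\<^sup>2)"
  proof (intro divide_right_mono mult_mono \<open>norm (1 - l) \<le> 2\<close>)
    show "norm (l - \<tau>) \<le> K * (1 - (norm l)\<^sup>2)"
      using K mult_left_mono[OF sq \<open>K \<ge> 0\<close>] by linarith
    then show "0 \<le> 2 * (K * (1 - (norm l)\<^sup>2))"
      using norm_ge_zero[of "l - \<tau>"] by linarith
  qed auto
  also have "\<dots> = 4 * K / norm (1 - \<tau>) * Im (disc_to_half_plane l)"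
    by (simp add: Im_disc_to_half_plane[OF l1])
  finally show ?thesis .
qed

text \<open>The maximum principle, read off from the rigidity of Pick functions with a real value:
  \<open>\<i> (1 - cnj (\<phi> m) \<phi>)\<close> has non-negative imaginary part and vanishes at \<open>m\<close>.\<close>

lemma schur_class2_constant_if_unimodular:
  assumes \<phi>: "\<phi> \<in> schur_class2" and m: "m \<in> bidisc" "norm (\<phi> m) = 1" and l: "l \<in> bidisc"
  shows "\<phi> l = \<phi> m"
proof -
  let ?P = "upper_half_plane" and ?L = half_plane_to_disc and ?D = disc_to_half_plane
  define G where "G p = \<i> * (1 - cnj (\<phi> m) * \<phi> (?L (fst p), ?L (snd p)))" for p
  have bidisc: "(?L z1, ?L z2) \<in> bidisc" if "Im z1 > 0" "Im z2 > 0" for z1 z2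
    using that by (simp add: mem_bidisc_iff norm_half_plane_to_disc_less_1)
  have L_hol: "?L holomorphic_on ?P"
    by (rule holomorphic_on_subset[OF holomorphic_half_plane_to_disc]) auto
  have "(\<lambda>p. \<phi> (?L (fst p), ?L (snd p))) holomorphic2_on (?P \<times> ?P)"
    using \<phi> bidisc by (intro holomorphic2_on_coordinatewise[of \<phi> bidisc] L_hol
        open_bidisc open_upper_half_plane) (auto simp: schur_class2_def)
  then have "G holomorphic2_on (?P \<times> ?P)"
    unfolding G_def
    by (rule holomorphic2_on_postcompose[where k = "\<lambda>x. \<i> * (1 - cnj (\<phi> m) * x)" and V = UNIV])
      (auto intro!: open_Times open_upper_half_plane holomorphic_intros)
  moreover have "Im (G p) \<ge> 0" if "p \<in> ?P \<times> ?P" for p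
  proof -
    have "norm (cnj (\<phi> m) * \<phi> (?L (fst p), ?L (snd p))) \<le> 1"
      using \<phi> bidisc that m by (auto simp: schur_class2_def norm_mult)
    then have "Re (cnj (\<phi> m) * \<phi> (?L (fst p), ?L (snd p))) \<le> 1"
      using complex_Re_le_cmod order_trans by blast
    then show ?thesis unfolding G_def by simp
  qed
  ultimately have G: "G \<in> pick_class2" by (simp add: pick_class2_def)
  have unit: "cnj (\<phi> m) * \<phi> m = 1"
    using m(2) complex_norm_square[of "\<phi> m"] by (simp add: mult.commute)
  have G_eq: "G (?D (fst p), ?D (snd p)) = \<i> * (1 - cnj (\<phi> m) * \<phi> p)" if "p \<in> bidisc" for p
  proof -
    have "fst p \<noteq> 1" "snd p \<noteq> 1" using that by (auto simp: bidisc_def)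
    then show ?thesis by (simp add: G_def half_plane_to_disc_inverse)
  qed
  have pos: "Im (?D (fst p)) > 0" "Im (?D (snd p)) > 0" if "p \<in> bidisc" for p
    using that by (auto simp: bidisc_def intro!: Im_disc_to_half_plane_pos)
  have 0: "G (?D (fst m), ?D (snd m)) = 0" using G_eq[OF m(1)] unit by simp
  have "G (?D (fst l), ?D (snd l)) = G (?D (fst m), ?D (snd m))"
    using 0 by (intro pick_class2_constant_if_real_value[OF G pos[OF l] pos[OF m(1)]]) simp
  then have "cnj (\<phi> m) * \<phi> l = cnj (\<phi> m) * \<phi> m" using G_eq[OF l] 0 unit by simp
  then show ?thesis using m(2) by auto
qed

text \<open>Both sides equal \<open>- 2 \<omega> \<alpha> (1 - Re \<tau>)\<close>, because \<open>(1 - a)\<^sup>2 = - 2 a (1 - Re a)\<close> on the unit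
  circle. This is where the value of \<open>\<beta>\<close> comes from: it is the gradient multiplied by the
  ratio of the derivatives of the Cayley transforms at \<open>\<omega>\<close> and \<open>\<tau>\<close>.\<close>

lemma angular_derivative_constant:
  assumes \<tau>: "norm \<tau> = 1" and \<omega>: "norm \<omega> = 1" "\<omega> \<noteq> 1"
    and \<beta>: "\<beta> = (1 - Re \<tau>) / (1 - Re \<omega>) * \<alpha>"
  shows "\<omega> * cnj \<tau> * of_real \<alpha> * (1 - \<tau>)\<^sup>2 = of_real \<beta> * (1 - \<omega>)\<^sup>2"
proof -
  have unit: "a * cnj a = 1" if "norm a = 1" for a :: complex
    using that complex_norm_square[of a] by simp
  have sq: "(1 - a)\<^sup>2 = - 2 * a * of_real (1 - Re a)" if "norm a = 1" for a :: complex
  proof -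
    have "of_real (2 * Re a) = a + cnj a" by (simp add: complex_eq_iff)
    then have "- 2 * a * of_real (1 - Re a) = - 2 * a + a * (a + cnj a)"
      by (simp add: algebra_simps)
    also have "\<dots> = (1 - a)\<^sup>2" using unit[OF that] by (simp add: power2_eq_square algebra_simps)
    finally show ?thesis ..
  qed
  have "Re \<omega> \<noteq> 1"
  proof
    assume "Re \<omega> = 1"
    with \<omega>(1) have "Im \<omega> = 0" using cmod_power2[of \<omega>] by simp
    with \<open>Re \<omega> = 1\<close> \<omega>(2) show False by (simp add: complex_eq_iff)
  qed
  then have \<beta>': "\<beta> * (1 - Re \<omega>) = (1 - Re \<tau>) * \<alpha>" by (simp add: \<beta>)
  have "\<omega> * cnj \<tau> * of_real \<alpha> * (1 - \<tau>)\<^sup>2 = - 2 * \<omega> * (\<tau> * cnj \<tau>) * of_real ((1 - Re \<tau>) * \<alpha>)"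
    unfolding sq[OF \<tau>] by (simp add: algebra_simps)
  also have "\<dots> = of_real \<beta> * (- 2 * \<omega> * of_real (1 - Re \<omega>))"
    unfolding \<beta>'[symmetric] unit[OF \<tau>] by (simp add: algebra_simps)
  finally show ?thesis unfolding sq[OF \<omega>(1)] .
qed

section \<open>The vertical approach to the boundary point\<close>

text \<open>The curve in the bidisc that corresponds to the half-line on which the limit of \<open>y g\<close> is taken.
  It serves as the standard nontangential approach to the boundary point.\<close>

definition vertical_path :: "complex \<Rightarrow> complex \<Rightarrow> real \<Rightarrow> complex \<times> complex" where
  "vertical_path \<tau>1 \<tau>2 y = (half_plane_to_disc (disc_to_half_plane \<tau>1 + \<i> * of_real y), \<tau>2)"

lemma vertical_path_tendsto:
  assumes "norm \<tau>1 = 1" "\<tau>1 \<noteq> 1"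
  shows "(vertical_path \<tau>1 \<tau>2 \<longlongrightarrow> (\<tau>1, \<tau>2)) (at_right 0)"
proof -
  let ?x = "disc_to_half_plane \<tau>1"
  have "isCont half_plane_to_disc ?x"
    using holomorphic_on_imp_continuous_on[OF holomorphic_half_plane_to_disc]
      disc_to_half_plane_neq_minus_i[of \<tau>1]
    by (simp add: continuous_on_eq_continuous_at open_Compl)
  then have "((\<lambda>y::real. half_plane_to_disc (?x + \<i> * of_real y)) \<longlongrightarrow> half_plane_to_disc ?x) (at_right 0)"
    by (rule isCont_tendsto_compose) (auto intro!: tendsto_eq_intros)
  then show ?thesis
    unfolding vertical_path_def half_plane_to_disc_inverse[OF assms(2)]
    by (intro tendsto_Pair tendsto_const)
qed

lemma vertical_path_nontangential:
  assumes \<tau>: "norm \<tau>1 = 1" "\<tau>1 \<noteq> 1" "norm \<tau>2 < 1"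
  shows "approaches_nontangentially (vertical_path \<tau>1 \<tau>2 ` {0<..1}) (\<tau>1, \<tau>2)"
proof (rule approaches_nontangentiallyI[where K = "max 2 (2 / (1 - norm \<tau>2))"])
  let ?S = "vertical_path \<tau>1 \<tau>2 ` {0<..1}" and ?x = "disc_to_half_plane \<tau>1"
  have x: "Im ?x = 0" using \<tau> by (simp add: Im_disc_to_half_plane_eq_0)
  have in_disc: "norm (half_plane_to_disc (?x + \<i> * of_real y)) < 1" if "y > 0" for y
    using that x by (intro norm_half_plane_to_disc_less_1) simp
  then show "?S \<subseteq> bidisc"
    using \<tau> by (auto simp: vertical_path_def mem_bidisc_iff)
  show "(\<tau>1, \<tau>2) \<notin> bidisc" using \<tau> by (simp add: mem_bidisc_iff)
  show "(\<tau>1, \<tau>2) \<in> closure ?S"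
  proof (rule Lim_in_closed_set[OF closed_closure _ _ vertical_path_tendsto[OF \<tau>(1,2)]])
    have "\<forall>\<^sub>F y in at_right 0. y \<in> {0<..<1::real}" by (rule eventually_at_right_real) simp
    then show "\<forall>\<^sub>F y in at_right 0. vertical_path \<tau>1 \<tau>2 y \<in> closure ?S"
      by eventually_elim (auto intro!: subsetD[OF closure_subset])
  qed simp
  fix l assume "l \<in> ?S"
  then obtain y where y: "0 < y" "y \<le> 1" and l: "l = vertical_path \<tau>1 \<tau>2 y" by auto
  define z where "z = ?x + \<i> * of_real y"
  define a where "a = half_plane_to_disc z"
  have Im_z: "Im z = y" using x by (simp add: z_def)
  have a: "norm a < 1" using in_disc y by (simp add: a_def z_def)
  have ne: "z \<noteq> - \<i>" "?x \<noteq> - \<i>"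
    using Im_z y disc_to_half_plane_neq_minus_i by auto
  have ge: "norm (?x + \<i>) \<ge> 1" "norm (z + \<i>) \<ge> 1"
    using abs_Im_le_cmod[of "?x + \<i>"] abs_Im_le_cmod[of "z + \<i>"] x Im_z y by auto
  have "norm (z + \<i>) \<le> norm (?x + \<i>) + norm (\<i> * of_real y)"
    using norm_triangle_ineq[of "?x + \<i>" "\<i> * of_real y"] by (simp add: z_def algebra_simps)
  then have le: "norm (z + \<i>) \<le> 2 * norm (?x + \<i>)" using y ge by (simp add: norm_mult)
  have "norm (a - \<tau>1) = 2 * y / (norm (z + \<i>) * norm (?x + \<i>))"
    using half_plane_to_disc_diff[OF ne] half_plane_to_disc_inverse[OF \<tau>(2)] y
    by (simp add: a_def norm_divide norm_mult z_def)
  also have "\<dots> = 2 * y * norm (z + \<i>) / ((norm (z + \<i>))\<^sup>2 * norm (?x + \<i>))"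
    using ge by (simp add: power2_eq_square)
  also have "\<dots> \<le> 2 * y * (2 * norm (?x + \<i>)) / ((norm (z + \<i>))\<^sup>2 * norm (?x + \<i>))"
    using le y by (intro divide_right_mono mult_left_mono) auto
  also have "\<dots> = 2 * (2 * y / (norm (z + \<i>))\<^sup>2)"
  proof -
    have "norm (?x + \<i>) \<noteq> 0" using ge by linarith
    then show ?thesis by (simp del: norm_eq_zero)
  qed
  also have "\<dots> \<le> 2 * (1 - norm a)"
    using one_minus_norm_half_plane_to_disc[of z] Im_z y by (simp add: a_def)
  finally have 1: "norm (a - \<tau>1) \<le> 2 * (1 - norm a)" .
  \<comment> \<open>This bound serves the case that the fixed second coordinate is the one closer
    to the circle.\<close>
  have "norm (a - \<tau>1) \<le> 2" using norm_triangle_ineq4[of a \<tau>1] \<tau> a by simp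
  moreover have "2 / (1 - norm \<tau>2) * (1 - norm \<tau>2) = 2" using \<tau> by (simp add: divide_simps)
  ultimately have 2: "norm (a - \<tau>1) \<le> 2 / (1 - norm \<tau>2) * (1 - norm \<tau>2)" by simp
  have "norm (a - \<tau>1) \<le> max 2 (2 / (1 - norm \<tau>2)) * (1 - norm a)"
    by (rule order_trans[OF 1 mult_right_mono]) (use a in auto)
  moreover have "norm (a - \<tau>1) \<le> max 2 (2 / (1 - norm \<tau>2)) * (1 - norm \<tau>2)"
    by (rule order_trans[OF 2 mult_right_mono]) (use \<tau> in auto)
  ultimately show "max_norm (l - (\<tau>1, \<tau>2)) \<le> max 2 (2 / (1 - norm \<tau>2)) * (1 - max_norm l)"
    by (simp add: l vertical_path_def max_norm_def a_def z_def)
qed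

text \<open>Limits along the approach set of the vertical path thereby become limits in the
  parameter \<open>y\<close>.\<close>

lemma vertical_path_filterlim:
  assumes \<tau>: "norm \<tau>1 = 1" "\<tau>1 \<noteq> 1" "norm \<tau>2 < 1"
  shows "filterlim (vertical_path \<tau>1 \<tau>2) (at (\<tau>1, \<tau>2) within vertical_path \<tau>1 \<tau>2 ` {0<..1}) (at_right 0)"
  unfolding filterlim_at
proof (intro conjI vertical_path_tendsto \<tau>)
  have out: "(\<tau>1, \<tau>2) \<notin> vertical_path \<tau>1 \<tau>2 ` {0<..1}"
    using vertical_path_nontangential[OF \<tau>] \<tau>
    unfolding approaches_nontangentially_def by (metis mem_bidisc_iff order_less_irrefl subsetD)
  have "\<forall>\<^sub>F y in at_right 0. y \<in> {0<..<1::real}" by (rule eventually_at_right_real) simp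
  then show "\<forall>\<^sub>F y in at_right 0. vertical_path \<tau>1 \<tau>2 y \<in> vertical_path \<tau>1 \<tau>2 ` {0<..1} \<and>
      vertical_path \<tau>1 \<tau>2 y \<noteq> (\<tau>1, \<tau>2)"
  proof eventually_elim
    case (elim y)
    then have "vertical_path \<tau>1 \<tau>2 y \<in> vertical_path \<tau>1 \<tau>2 ` {0<..1}" by auto
    with out show ?case by metis
  qed
qed

section \<open>The parametrization\<close>

text \<open>From \<open>u g \<longlonglongrightarrow> 0\<close> follows \<open>H / u \<longlonglongrightarrow> \<beta>\<close> along every nontangential approach, hence
  \<open>(\<phi> - \<omega>) / (l1 - \<tau>1) \<longlonglongrightarrow> \<eta>\<close>; the three boundary properties are consequences of this
  single limit.\<close>

lemma angular_data_of_pick_parameter: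
  assumes \<tau>: "norm \<tau>1 = 1" "\<tau>1 \<noteq> 1" "norm \<tau>2 < 1" and \<omega>: "norm \<omega> = 1" "\<omega> \<noteq> 1"
    and \<beta>: "\<beta> > 0" and \<eta>: "\<eta> * (1 - \<tau>1)\<^sup>2 = of_real \<beta> * (1 - \<omega>)\<^sup>2"
    and g: "g \<in> pick_class2"
    and lim: "((\<lambda>y::real. of_real y * g (disc_to_half_plane \<tau>1 + \<i> * of_real y, disc_to_half_plane \<tau>2))
        \<longlongrightarrow> 0) (at_right 0)"
    and \<phi>: "\<And>l1 l2. (l1, l2) \<in> bidisc \<Longrightarrow> \<phi> (l1, l2) = half_plane_to_disc (disc_to_half_plane \<omega> +
        1 / (1 / (of_real \<beta> * (disc_to_half_plane l1 - disc_to_half_plane \<tau>1))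
             - g (disc_to_half_plane l1, disc_to_half_plane l2)))"
  shows "\<phi> \<in> schur_class2" "B_point \<phi> (\<tau>1, \<tau>2)" "has_nontangential_limit \<phi> (\<tau>1, \<tau>2) \<omega>"
    "has_angular_gradient \<phi> (\<tau>1, \<tau>2) (\<eta>, 0)"
proof -
  let ?P = "upper_half_plane" and ?D = disc_to_half_plane and ?L = half_plane_to_disc
  define x c where "x = ?D \<tau>1" and "c = ?D \<omega>"
  have x: "Im x = 0" and c: "Im c = 0"
    using \<tau> \<omega> by (auto simp: x_def c_def Im_disc_to_half_plane_eq_0)
  define q where "q p = 1 / (of_real \<beta> * (fst p - x)) - g p" for p
  have Im_q: "Im (q p) < 0" if "p \<in> ?P \<times> ?P" for p
  proof -
    have "Im (of_real \<beta> * (fst p - x)) > 0" using that x \<beta> by auto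
    moreover from this have "of_real \<beta> * (fst p - x) \<noteq> 0" by auto
    ultimately have "Im (1 / (of_real \<beta> * (fst p - x))) < 0"
      unfolding Im_one_divide by (intro divide_neg_pos) auto
    moreover have "Im (g p) \<ge> 0" using that g unfolding pick_class2_def by blast
    ultimately show ?thesis by (simp add: q_def)
  qed
  have Im_inv_pos: "Im (1 / v) > 0" if "Im v < 0" for v
    unfolding Im_one_divide using that by (intro divide_pos_pos) auto
  have \<phi>q: "\<phi> l = ?L (c + 1 / q (?D (fst l), ?D (snd l)))" if "l \<in> bidisc" for l
    using \<phi>[of "fst l" "snd l"] that by (simp add: q_def x_def c_def)
  have D_in: "?D (fst l) \<in> ?P" "?D (snd l) \<in> ?P" if "l \<in> bidisc" for l
    using that by (auto simp: bidisc_def intro!: Im_disc_to_half_plane_pos)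
  have Im_h: "Im (c + 1 / q (?D (fst l), ?D (snd l))) > 0" if "l \<in> bidisc" for l
    using Im_inv_pos[OF Im_q] D_in[OF that] c by simp
  have open_P2: "open (?P \<times> ?P)" by (intro open_Times open_upper_half_plane)

  show "\<phi> \<in> schur_class2"
    unfolding schur_class2_def
  proof (intro CollectI conjI ballI)
    have "(\<lambda>p. 1 / (of_real \<beta> * (fst p - x))) holomorphic2_on (?P \<times> ?P)"
      using x \<beta> by (intro holomorphic2_on_postcompose[OF holomorphic2_on_fst open_P2,
            of "\<lambda>z. 1 / (of_real \<beta> * (z - x))" ?P])
        (auto intro!: holomorphic_intros open_upper_half_plane)
    then have "q holomorphic2_on (?P \<times> ?P)"
      unfolding q_def[abs_def] using g by (intro holomorphic2_on_diff) (auto simp: pick_class2_def)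
    moreover have D_hol: "?D holomorphic_on ball 0 1"
      by (rule holomorphic_on_subset[OF holomorphic_disc_to_half_plane]) auto
    ultimately have "(\<lambda>l. q (?D (fst l), ?D (snd l))) holomorphic2_on bidisc"
      unfolding bidisc_def
      by (intro holomorphic2_on_coordinatewise[of q "?P \<times> ?P"] open_P2)
        (auto intro!: Im_disc_to_half_plane_pos)
    moreover have "(\<lambda>v. ?L (c + 1 / v)) holomorphic_on {v. Im v < 0}"
    proof -
      have "(\<lambda>v. c + 1 / v) holomorphic_on {v. Im v < 0}"
        by (intro holomorphic_intros) auto
      moreover have "(\<lambda>v. c + 1 / v) ` {v. Im v < 0} \<subseteq> - {- \<i>}"
      proof (rule image_subsetI)
        fix v :: complex assume "v \<in> {v. Im v < 0}"
        then have "Im (c + 1 / v) > 0" using Im_inv_pos[of v] c by simp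
        then show "c + 1 / v \<in> - {- \<i>}" using neq_minus_i[of "c + 1 / v"] by simp
      qed
      ultimately show ?thesis
        using holomorphic_on_compose_gen[OF _ holomorphic_half_plane_to_disc] by (simp add: o_def)
    qed
    ultimately have "(\<lambda>l. ?L (c + 1 / q (?D (fst l), ?D (snd l)))) holomorphic2_on bidisc"
      using Im_q D_in
      by (intro holomorphic2_on_postcompose[OF _ open_bidisc, where k = "\<lambda>v. ?L (c + 1 / v)"
            and V = "{v. Im v < 0}"]) (auto simp: open_halfspace_Im_lt)
    then show "\<phi> holomorphic2_on bidisc"
      by (rule holomorphic2_on_cong) (simp add: \<phi>q)
    show "norm (\<phi> l) \<le> 1" if "l \<in> bidisc" for l
      using norm_half_plane_to_disc_less_1[OF Im_h[OF that]] \<phi>q[OF that] by simp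
  qed

  have quotient: "((\<lambda>l. (\<phi> l - \<omega>) / (fst l - \<tau>1)) \<longlongrightarrow> \<eta>) (at (\<tau>1, \<tau>2) within S)"
    if S: "approaches_nontangentially S (\<tau>1, \<tau>2)" for S
  proof -
    let ?F = "at (\<tau>1, \<tau>2) within S"
    have sub: "S \<subseteq> bidisc" using S by (simp add: approaches_nontangentially_def)
    define u where "u l = ?D (fst l) - x" for l :: "complex \<times> complex"
    define G where "G l = g (?D (fst l), ?D (snd l))" for l
    define H where "H l = 1 / q (?D (fst l), ?D (snd l))" for l
    have in_S: "\<forall>\<^sub>F l in ?F. l \<in> S" by (rule eventually_mem_within)
    have D_lim: "((\<lambda>l. ?D (f l)) \<longlongrightarrow> ?D a) ?F" if "(f \<longlongrightarrow> a) ?F" "a \<noteq> 1" for f a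
      unfolding disc_to_half_plane_def using that by (intro tendsto_intros) auto
    have fst_lim: "(fst \<longlongrightarrow> \<tau>1) ?F" and snd_lim: "(snd \<longlongrightarrow> \<tau>2) ?F"
      using tendsto_coordinates_within[of "(\<tau>1, \<tau>2)" S] by simp_all
    have z_lim: "((\<lambda>l. ?D (fst l)) \<longlongrightarrow> x) ?F" "((\<lambda>l. ?D (snd l)) \<longlongrightarrow> ?D \<tau>2) ?F"
      unfolding x_def using \<tau> by (auto intro!: D_lim fst_lim snd_lim)
    then have u_lim: "(u \<longlongrightarrow> 0) ?F"
      unfolding u_def[abs_def] using tendsto_diff[OF z_lim(1) tendsto_const[of x]] by simp
    obtain K where K: "\<And>l. l \<in> S \<Longrightarrow> max_norm (l - (\<tau>1, \<tau>2)) \<le> K * (1 - max_norm l)" "K \<ge> 1"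
      using approaches_nontangentiallyE[OF S] by blast
    have sector: "norm (u l) \<le> 4 * K / norm (1 - \<tau>1) * Im (?D (fst l))" if "l \<in> S" for l
    proof -
      have "norm (fst l - \<tau>1) \<le> max_norm (l - (\<tau>1, \<tau>2))"
        using norm_coordinate_le_max_norm(1)[of "l - (\<tau>1, \<tau>2)"] by simp
      also have "\<dots> \<le> K * (1 - max_norm l)" by (rule K(1)[OF that])
      also have "\<dots> \<le> K * (1 - norm (fst l))"
        using K(2) norm_coordinate_le_max_norm(1)[of l] by (intro mult_left_mono) auto
      finally show ?thesis
        unfolding u_def x_def using that sub \<tau>
        by (intro nontangential_in_half_plane) (auto simp: bidisc_def)
    qed
    \<comment> \<open>With \<open>H = 1 / (1 / (\<beta> u) - g)\<close> one has \<open>H / u = \<beta> / (1 - \<beta> u g)\<close>, so everything depends on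
      the decay of \<open>u g\<close>.\<close>
    have uG: "((\<lambda>l. u l * G l) \<longlongrightarrow> 0) ?F"
      unfolding u_def G_def
    proof (rule nontangentially_negligible[OF g x])
      show "((\<lambda>y. of_real y * g (x + \<i> * of_real y, ?D \<tau>2)) \<longlongrightarrow> 0) (at_right 0)"
        using lim by (simp add: x_def)
      show "Im (?D \<tau>2) > 0" by (rule Im_disc_to_half_plane_pos[OF \<tau>(3)])
      show "1 \<le> max 1 (4 * K / norm (1 - \<tau>1))" by simp
      show "\<forall>\<^sub>F l in ?F. 0 < Im (?D (fst l)) \<and> 0 < Im (?D (snd l)) \<and>
          norm (?D (fst l) - x) \<le> max 1 (4 * K / norm (1 - \<tau>1)) * Im (?D (fst l))"
        using in_S
      proof eventually_elim
        case (elim l)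
        then have pos: "0 < Im (?D (fst l))" "0 < Im (?D (snd l))" using sub D_in[of l] by auto
        have "norm (?D (fst l) - x) \<le> 4 * K / norm (1 - \<tau>1) * Im (?D (fst l))"
          using sector[OF elim] by (simp only: u_def)
        also have "\<dots> \<le> max 1 (4 * K / norm (1 - \<tau>1)) * Im (?D (fst l))"
          using pos by (intro mult_right_mono) auto
        finally show ?case using pos by blast
      qed
    qed (rule z_lim)+
    have "((\<lambda>l. of_real \<beta> / (1 - of_real \<beta> * (u l * G l))) \<longlongrightarrow> of_real \<beta> / (1 - of_real \<beta> * 0)) ?F"
      by (intro tendsto_intros uG) simp
    moreover have "\<forall>\<^sub>F l in ?F. of_real \<beta> / (1 - of_real \<beta> * (u l * G l)) = H l / u l"
      using in_S
    proof eventually_elim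
      case (elim l)
      have "u l \<noteq> 0" using D_in[of l] elim sub x by (auto simp: u_def)
      moreover have "q (?D (fst l), ?D (snd l)) = (1 - of_real \<beta> * (u l * G l)) / (of_real \<beta> * u l)"
        using \<open>u l \<noteq> 0\<close> \<beta> by (simp add: q_def u_def G_def divide_simps)
      ultimately show ?case by (simp add: H_def)
    qed
    ultimately have Hu_lim: "((\<lambda>l. H l / u l) \<longlongrightarrow> of_real \<beta>) ?F"
      using Lim_transform_eventually by fastforce
    have u_ne: "u l \<noteq> 0" if "l \<in> S" for l using D_in[of l] that sub x by (auto simp: u_def)
    have "((\<lambda>l. H l / u l * u l) \<longlongrightarrow> of_real \<beta> * 0) ?F"
      by (intro tendsto_mult Hu_lim u_lim)
    moreover have "\<forall>\<^sub>F l in ?F. H l / u l * u l = H l"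
      using in_S by eventually_elim (simp add: u_ne)
    ultimately have "(H \<longlongrightarrow> of_real \<beta> * 0) ?F" by (rule Lim_transform_eventually)
    then have H_lim: "(H \<longlongrightarrow> 0) ?F" by simp
    have c_ne: "c + \<i> \<noteq> 0" using c by (auto simp: complex_eq_iff)
    have "((\<lambda>l. ?L (c + H l)) \<longlongrightarrow> ?L (c + 0)) ?F"
      unfolding half_plane_to_disc_def using c_ne by (intro tendsto_intros H_lim) simp
    moreover have "\<forall>\<^sub>F l in ?F. ?L (c + H l) = \<phi> l"
      using in_S by eventually_elim (use sub in \<open>auto simp: \<phi>q H_def\<close>)
    ultimately have "(\<phi> \<longlongrightarrow> ?L (c + 0)) ?F" by (rule Lim_transform_eventually)
    then have \<phi>_lim: "(\<phi> \<longlongrightarrow> \<omega>) ?F" using \<omega> by (simp add: c_def half_plane_to_disc_inverse)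
    have \<eta>_eq: "of_real \<beta> * ((1 - \<omega>) * (1 - \<omega>) / ((1 - \<tau>1) * (1 - \<tau>1))) = \<eta>"
      using \<eta> \<tau> by (simp add: power2_eq_square divide_simps)
    have "((\<lambda>l. H l / u l * ((1 - \<phi> l) * (1 - \<omega>) / ((1 - fst l) * (1 - \<tau>1)))) \<longlongrightarrow> \<eta>) ?F"
      unfolding \<eta>_eq[symmetric] using \<tau> by (intro tendsto_intros Hu_lim \<phi>_lim fst_lim) simp
    moreover have "\<forall>\<^sub>F l in ?F. H l / u l * ((1 - \<phi> l) * (1 - \<omega>) / ((1 - fst l) * (1 - \<tau>1)))
        = (\<phi> l - \<omega>) / (fst l - \<tau>1)"
      using in_S
    proof eventually_elim
      case (elim l)
      have l: "l \<in> bidisc" using elim sub by auto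
      have ne: "\<phi> l \<noteq> 1" "fst l \<noteq> 1" 
        using norm_half_plane_to_disc_less_1[OF Im_h[OF l]] \<phi>q[OF l] l by (auto simp: bidisc_def)
      have "Im (c + H l) > 0" using Im_h[OF l] by (simp only: H_def)
      then have "c + H l \<noteq> - \<i>" by (intro neq_minus_i) simp
      then have "H l = ?D (\<phi> l) - ?D \<omega>"
        using \<phi>q[OF l] disc_to_half_plane_inverse[of "c + H l"] by (simp add: c_def H_def)
      then show ?case
        unfolding u_def x_def disc_quotient[OF ne(1) \<omega>(2) ne(2) \<tau>(2)] by (simp only:)
    qed
    ultimately show ?thesis by (rule Lim_transform_eventually)
  qed

  have expansion: "first_order_expansion \<phi> (\<tau>1, \<tau>2) S \<omega> (\<eta>, 0)"
    if S: "approaches_nontangentially S (\<tau>1, \<tau>2)" for S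
  proof (rule first_order_expansion_if_quotient_tendsto)
    show "((\<lambda>l. (\<phi> l - \<omega>) / (fst l - fst (\<tau>1, \<tau>2))) \<longlongrightarrow> \<eta>) (at (\<tau>1, \<tau>2) within S)"
      using quotient[OF S] by simp
    show "fst l \<noteq> fst (\<tau>1, \<tau>2)" if "l \<in> S" for l
      using that S \<tau> by (auto simp: approaches_nontangentially_def bidisc_def)
  qed
  show "has_nontangential_limit \<phi> (\<tau>1, \<tau>2) \<omega>"
    unfolding has_nontangential_limit_def
    by (intro allI impI first_order_expansion_imp_tendsto[OF expansion])
  let ?S = "vertical_path \<tau>1 \<tau>2 ` {0<..1}"
  have S: "approaches_nontangentially ?S (\<tau>1, \<tau>2)" by (rule vertical_path_nontangential[OF \<tau>])
  then show "has_angular_gradient \<phi> (\<tau>1, \<tau>2) (\<eta>, 0)"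
    using expansion \<omega>
    unfolding has_angular_gradient_def C_point_def approaches_nontangentially_def by blast
  show "B_point \<phi> (\<tau>1, \<tau>2)"
  proof (rule B_pointI[OF S \<omega>(1)])
    have "\<forall>\<^sub>F l in at (\<tau>1, \<tau>2) within ?S. norm ((\<phi> l - \<omega>) / (fst l - \<tau>1)) < norm \<eta> + 1"
      by (rule order_tendstoD(2)[OF tendsto_norm[OF quotient[OF S]]]) simp
    then show "\<forall>\<^sub>F l in at (\<tau>1, \<tau>2) within ?S.
        norm (\<phi> l - \<omega>) \<le> (norm \<eta> + 1) * max_norm (l - (\<tau>1, \<tau>2))"
      using eventually_mem_within
    proof eventually_elim
      case (elim l)
      have "fst l \<noteq> \<tau>1"
        using elim S \<tau> by (auto simp: approaches_nontangentially_def bidisc_def)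
      then have "norm (\<phi> l - \<omega>) \<le> (norm \<eta> + 1) * norm (fst l - \<tau>1)"
        using elim by (simp add: norm_divide divide_simps)
      also have "\<dots> \<le> (norm \<eta> + 1) * max_norm (l - (\<tau>1, \<tau>2))"
        using norm_coordinate_le_max_norm(1)[of "l - (\<tau>1, \<tau>2)"] by (intro mult_left_mono) auto
      finally show ?case .
    qed
  qed
qed

text \<open>Solving the formula for \<open>g\<close> leaves no choice but \<open>g = 1 / (\<beta> u) - 1 / H\<close>. Along the vertical
  path the gradient gives \<open>H / u \<longlonglongrightarrow> \<beta>\<close>, which is the hypothesis of the Julia inequality, hence the
  sign of \<open>Im g\<close>, and at the same time the decay of \<open>y g\<close>.\<close>

lemma pick_parameter_of_angular_data:
  assumes \<tau>: "norm \<tau>1 = 1" "\<tau>1 \<noteq> 1" "norm \<tau>2 < 1" and \<omega>: "norm \<omega> = 1" "\<omega> \<noteq> 1"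
    and \<beta>: "\<beta> > 0" and \<eta>: "\<eta> * (1 - \<tau>1)\<^sup>2 = of_real \<beta> * (1 - \<omega>)\<^sup>2"
    and \<phi>: "\<phi> \<in> schur_class2" and nt: "has_nontangential_limit \<phi> (\<tau>1, \<tau>2) \<omega>"
    and grad: "has_angular_gradient \<phi> (\<tau>1, \<tau>2) (\<eta>, 0)"
  obtains g where "g \<in> pick_class2"
    "((\<lambda>y::real. of_real y * g (disc_to_half_plane \<tau>1 + \<i> * of_real y, disc_to_half_plane \<tau>2))
        \<longlongrightarrow> 0) (at_right 0)"
    "\<And>l1 l2. (l1, l2) \<in> bidisc \<Longrightarrow> \<phi> (l1, l2) = half_plane_to_disc (disc_to_half_plane \<omega> +
        1 / (1 / (of_real \<beta> * (disc_to_half_plane l1 - disc_to_half_plane \<tau>1))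
             - g (disc_to_half_plane l1, disc_to_half_plane l2)))"
proof -
  let ?P = "upper_half_plane" and ?D = disc_to_half_plane and ?L = half_plane_to_disc
  let ?S = "vertical_path \<tau>1 \<tau>2 ` {0<..1}" and ?v = "vertical_path \<tau>1 \<tau>2"
  define x where "x = ?D \<tau>1"
  have x: "Im x = 0" using \<tau> by (auto simp: x_def Im_disc_to_half_plane_eq_0)
  have z0: "Im (?D \<tau>2) > 0" by (rule Im_disc_to_half_plane_pos[OF \<tau>(3)])
  have S: "approaches_nontangentially ?S (\<tau>1, \<tau>2)" by (rule vertical_path_nontangential[OF \<tau>])
  note vfil = vertical_path_filterlim[OF \<tau>]
  have pos: "\<forall>\<^sub>F y::real in at_right 0. y > 0" by (rule eventually_at_right_less)
  have v_in: "?v y \<in> bidisc" "fst (?v y) \<noteq> \<tau>1" if "y > 0" for y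
  proof -
    have "norm (?L (?D \<tau>1 + \<i> * of_real y)) < 1"
      using that x by (intro norm_half_plane_to_disc_less_1) (simp add: x_def)
    then show "?v y \<in> bidisc" "fst (?v y) \<noteq> \<tau>1"
      using \<tau> by (auto simp: vertical_path_def mem_bidisc_iff)
  qed

  have exp: "first_order_expansion \<phi> (\<tau>1, \<tau>2) ?S \<omega> (\<eta>, 0)"
  proof -
    obtain w where w: "first_order_expansion \<phi> (\<tau>1, \<tau>2) ?S w (\<eta>, 0)"
      using grad S by (auto simp: has_angular_gradient_def)
    have "w = \<omega>"
      using tendsto_unique[OF approaches_nontangentially_not_bot[OF S]
          first_order_expansion_imp_tendsto[OF w]] nt S
      by (auto simp: has_nontangential_limit_def)
    then show ?thesis using w by simp
  qed
  have q_lim: "((\<lambda>y. (\<phi> (?v y) - \<omega>) / (fst (?v y) - \<tau>1)) \<longlongrightarrow> \<eta>) (at_right 0)"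
  proof -
    define e where "e l = (\<phi> l - (\<omega> + \<eta> * (fst l - \<tau>1))) / of_real (max_norm (l - (\<tau>1, \<tau>2)))" for l
    have "(e \<longlongrightarrow> 0) (at (\<tau>1, \<tau>2) within ?S)"
      using exp by (simp add: first_order_expansion_def e_def[abs_def])
    from filterlim_compose[OF this vfil]
    have e_lim: "((\<lambda>y. norm (e (?v y))) \<longlongrightarrow> 0) (at_right 0)"
      by (rule tendsto_norm_zero)
    have "((\<lambda>y. (\<phi> (?v y) - \<omega>) / (fst (?v y) - \<tau>1) - \<eta>) \<longlongrightarrow> 0) (at_right 0)"
    proof (rule Lim_null_comparison[OF _ e_lim])
      show "\<forall>\<^sub>F y in at_right 0. norm ((\<phi> (?v y) - \<omega>) / (fst (?v y) - \<tau>1) - \<eta>) \<le> norm (e (?v y))"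
        using pos
      proof eventually_elim
        case (elim y)
        let ?d = "fst (?v y) - \<tau>1"
        have d: "?d \<noteq> 0" using v_in(2)[OF elim] by simp
        \<comment> \<open>On the vertical path the second coordinate is constant.\<close>
        have "max_norm (?v y - (\<tau>1, \<tau>2)) = norm ?d"
          by (simp add: max_norm_def vertical_path_def)
        moreover have "(\<phi> (?v y) - \<omega>) / ?d - \<eta> = (\<phi> (?v y) - (\<omega> + \<eta> * ?d)) / ?d"
          using d by (simp add: field_simps)
        ultimately show ?case by (simp add: e_def norm_divide)
      qed
    qed
    from tendsto_add[OF this tendsto_const[of \<eta>]] show ?thesis by simp
  qed
  have \<eta>_ne: "\<eta> \<noteq> 0"
    using \<eta> \<beta> \<omega> by auto
  \<comment> \<open>A unimodular value would make \<open>\<phi>\<close> constant, so that \<open>\<eta> = 0\<close>. Strictness keeps \<open>\<phi>\<close> away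
    from \<open>1\<close> and from \<open>\<omega>\<close>, the points where the formulas for \<open>h\<close> and \<open>g\<close> divide by zero.\<close>
  have less_1: "norm (\<phi> l) < 1" if l: "l \<in> bidisc" for l
  proof (rule ccontr)
    assume "\<not> norm (\<phi> l) < 1"
    then have "norm (\<phi> l) = 1" using \<phi> l by (force simp: schur_class2_def)
    then have const: "\<phi> m = \<phi> l" if "m \<in> bidisc" for m
      using schur_class2_constant_if_unimodular[OF \<phi> l _ that] by blast
    have "(\<phi> \<longlongrightarrow> \<omega>) (at (\<tau>1, \<tau>2) within ?S)"
      by (rule first_order_expansion_imp_tendsto[OF exp])
    from filterlim_compose[OF this vfil] have "((\<lambda>y. \<phi> (?v y)) \<longlongrightarrow> \<omega>) (at_right 0)" .
    moreover have "\<forall>\<^sub>F y in at_right 0. \<phi> (?v y) = \<phi> l"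
      using pos by eventually_elim (simp add: const v_in)
    ultimately have "((\<lambda>y::real. \<phi> l) \<longlongrightarrow> \<omega>) (at_right 0)"
      by (rule Lim_transform_eventually)
    then have "\<phi> l = \<omega>" by (simp add: tendsto_const_iff)
    have "\<forall>\<^sub>F y in at_right 0. (\<phi> (?v y) - \<omega>) / (fst (?v y) - \<tau>1) = 0"
      using pos by eventually_elim (simp add: const v_in \<open>\<phi> l = \<omega>\<close>)
    with q_lim have "((\<lambda>y::real. 0) \<longlongrightarrow> \<eta>) (at_right 0)"
      by (rule Lim_transform_eventually)
    then show False using \<eta>_ne by (simp add: tendsto_const_iff)
  qed
  have \<phi>_ne: "\<phi> l \<noteq> 1" "\<phi> l \<noteq> \<omega>" if "l \<in> bidisc" for l
    using less_1[OF that] \<omega> by auto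

  define H where "H p = ?D (\<phi> (?L (fst p), ?L (snd p))) - ?D \<omega>" for p
  define g where "g p = 1 / (of_real \<beta> * (fst p - x)) - 1 / H p" for p
  have L_in: "(?L z1, ?L z2) \<in> bidisc" if "Im z1 > 0" "Im z2 > 0" for z1 z2
    using that by (simp add: mem_bidisc_iff norm_half_plane_to_disc_less_1)
  have open_P2: "open (?P \<times> ?P)" by (intro open_Times open_upper_half_plane)
  have L_hol: "?L holomorphic_on ?P"
    by (rule holomorphic_on_subset[OF holomorphic_half_plane_to_disc]) auto
  have "(\<lambda>p. \<phi> (?L (fst p), ?L (snd p))) holomorphic2_on (?P \<times> ?P)"
    using \<phi> L_in by (intro holomorphic2_on_coordinatewise[of \<phi> bidisc] L_hol
        open_bidisc open_upper_half_plane) (auto simp: schur_class2_def)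
  then have H_hol: "H holomorphic2_on (?P \<times> ?P)"
    unfolding H_def[abs_def] using L_in \<phi>_ne
    by (intro holomorphic2_on_postcompose[OF _ open_P2,
          where k = "\<lambda>w. ?D w - ?D \<omega>" and V = "- {1}"])
      (auto intro!: holomorphic_intros holomorphic_disc_to_half_plane)
  have H_pos: "Im (H p) > 0" if "p \<in> ?P \<times> ?P" for p
    using that Im_disc_to_half_plane_pos[OF less_1[OF L_in]] \<omega>
    by (auto simp: H_def Im_disc_to_half_plane_eq_0)
  have H: "H \<in> pick_class2"
    using H_hol H_pos by (auto simp: pick_class2_def less_imp_le)
  have H_ne: "H p \<noteq> 0" if "p \<in> ?P \<times> ?P" for p using H_pos[OF that] by auto

  have H_lim: "((\<lambda>y. H (x + \<i> * of_real y, ?D \<tau>2) / (\<i> * of_real y)) \<longlongrightarrow> of_real \<beta>) (at_right 0)"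
  proof -
    have fst_lim: "((\<lambda>y. fst (?v y)) \<longlongrightarrow> \<tau>1) (at_right 0)"
      using tendsto_fst[OF vertical_path_tendsto[OF \<tau>(1,2)]] by simp
    have \<phi>_lim: "((\<lambda>y. \<phi> (?v y)) \<longlongrightarrow> \<omega>) (at_right 0)"
      by (rule filterlim_compose[OF first_order_expansion_imp_tendsto[OF exp] vfil])
    have "((\<lambda>y. (\<phi> (?v y) - \<omega>) / (fst (?v y) - \<tau>1) *
          ((1 - fst (?v y)) * (1 - \<tau>1) / ((1 - \<phi> (?v y)) * (1 - \<omega>)))) \<longlongrightarrow>
        \<eta> * ((1 - \<tau>1) * (1 - \<tau>1) / ((1 - \<omega>) * (1 - \<omega>)))) (at_right 0)"
      using \<omega> by (intro tendsto_mult[OF q_lim] tendsto_intros fst_lim \<phi>_lim) simp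
    moreover have "\<eta> * ((1 - \<tau>1) * (1 - \<tau>1) / ((1 - \<omega>) * (1 - \<omega>))) = of_real \<beta>"
      using \<eta> \<omega> by (simp add: power2_eq_square divide_simps)
    moreover have "\<forall>\<^sub>F y in at_right 0. (\<phi> (?v y) - \<omega>) / (fst (?v y) - \<tau>1) *
          ((1 - fst (?v y)) * (1 - \<tau>1) / ((1 - \<phi> (?v y)) * (1 - \<omega>))) =
        H (x + \<i> * of_real y, ?D \<tau>2) / (\<i> * of_real y)"
      using pos
    proof eventually_elim
      case (elim y)
      have "x + \<i> * of_real y \<noteq> - \<i>" using x elim by (auto simp: complex_eq_iff)
      then have "?D (fst (?v y)) = x + \<i> * of_real y"
        by (simp add: vertical_path_def x_def disc_to_half_plane_inverse)
      then have "\<i> * of_real y = ?D (fst (?v y)) - ?D \<tau>1" by (simp add: x_def)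
      moreover have "\<tau>2 \<noteq> 1" using \<tau> by auto
      then have "H (x + \<i> * of_real y, ?D \<tau>2) = ?D (\<phi> (?v y)) - ?D \<omega>"
        by (simp add: H_def vertical_path_def x_def half_plane_to_disc_inverse)
      moreover have "fst (?v y) \<noteq> 1" using v_in(1)[OF elim] by (auto simp: bidisc_def)
      ultimately show ?case
        using disc_to_half_plane_quotient[OF \<phi>_ne(1)[OF v_in(1)[OF elim]] \<omega>(2) _ \<tau>(2)] by simp
    qed
    ultimately show ?thesis using Lim_transform_eventually by fastforce
  qed

  show thesis
  proof (rule that[of g])
    have "(\<lambda>p. 1 / (of_real \<beta> * (fst p - x))) holomorphic2_on (?P \<times> ?P)"
      using x \<beta> by (intro holomorphic2_on_postcompose[OF holomorphic2_on_fst open_P2,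
            of "\<lambda>z. 1 / (of_real \<beta> * (z - x))" ?P])
        (auto intro!: holomorphic_intros open_upper_half_plane)
    moreover have "(\<lambda>p. 1 / H p) holomorphic2_on (?P \<times> ?P)"
      using H_ne by (intro holomorphic2_on_postcompose[OF H_hol open_P2, of "\<lambda>z. 1 / z" "- {0}"])
        (auto intro!: holomorphic_intros)
    ultimately have "g holomorphic2_on (?P \<times> ?P)"
      unfolding g_def[abs_def] by (rule holomorphic2_on_diff)
    moreover have "Im (g p) \<ge> 0" if p: "p \<in> ?P \<times> ?P" for p
    proof -
      let ?u = "fst p - x"
      have u: "Im ?u = Im (fst p)" "?u \<noteq> 0" using p x by auto
      have "Im (fst p) * (norm (H p))\<^sup>2 \<le> \<beta> * Im (H p) * (norm ?u)\<^sup>2"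
        using Julia_inequality[OF H x z0 H_lim, of "fst p" "snd p"] p by auto
      then have "Im (fst p) / (\<beta> * (norm ?u)\<^sup>2) \<le> Im (H p) / (norm (H p))\<^sup>2"
        using u H_ne[OF p] \<beta> by (simp add: divide_simps mult_ac)
      moreover have "Im (1 / (of_real \<beta> * ?u)) = - (Im (fst p) / (\<beta> * (norm ?u)\<^sup>2))"
        unfolding Im_one_divide using \<beta> u
        by (simp add: norm_mult power_mult_distrib power2_eq_square[of \<beta>])
      ultimately show ?thesis by (simp add: g_def Im_one_divide)
    qed
    ultimately show "g \<in> pick_class2" by (simp add: pick_class2_def)

    \<comment> \<open>Above \<open>x\<close>, where \<open>fst p - x = \<i> y\<close>, the factor \<open>y\<close> cancels in both terms of \<open>y g\<close>.\<close>
    have "((\<lambda>y. 1 / (\<i> * of_real \<beta>) - 1 / (\<i> * (H (x + \<i> * of_real y, ?D \<tau>2) / (\<i> * of_real y)))) \<longlongrightarrow>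
        1 / (\<i> * of_real \<beta>) - 1 / (\<i> * of_real \<beta>)) (at_right 0)"
      using \<beta> by (intro tendsto_intros H_lim) simp
    moreover have "\<forall>\<^sub>F y in at_right 0. 1 / (\<i> * of_real \<beta>) -
          1 / (\<i> * (H (x + \<i> * of_real y, ?D \<tau>2) / (\<i> * of_real y)))
        = of_real y * g (?D \<tau>1 + \<i> * of_real y, ?D \<tau>2)"
      using pos
    proof eventually_elim
      case (elim y)
      have "H (x + \<i> * of_real y, ?D \<tau>2) \<noteq> 0" using elim x z0 by (intro H_ne) auto
      then show ?case using elim \<beta> by (simp add: g_def x_def field_simps)
    qed
    ultimately show "((\<lambda>y. of_real y * g (?D \<tau>1 + \<i> * of_real y, ?D \<tau>2)) \<longlongrightarrow> 0) (at_right 0)"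
      using Lim_transform_eventually by fastforce

    fix l1 l2 assume l: "(l1, l2) \<in> bidisc"
    then have "Im (?D l1) > 0" "Im (?D l2) > 0" "l1 \<noteq> 1" "l2 \<noteq> 1"
      by (auto simp: mem_bidisc_iff Im_disc_to_half_plane_pos)
    then show "\<phi> (l1, l2) = ?L (?D \<omega> + 1 / (1 / (of_real \<beta> * (?D l1 - ?D \<tau>1)) - g (?D l1, ?D l2)))"
      using \<phi>_ne(1)[OF l] by (simp add: g_def x_def H_def half_plane_to_disc_inverse)
  qed
qed

theorem theorem6p6:
  fixes \<tau>1 \<tau>2 \<omega> x1 :: complex and \<alpha> \<beta> :: real and \<phi> :: "complex \<times> complex \<Rightarrow> complex"
  assumes "norm \<tau>1 = 1" and "norm \<tau>2 < 1" and "norm \<omega> = 1" and "\<alpha> > 0"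
    and "\<tau>1 \<noteq> 1" and "\<omega> \<noteq> 1"
    and "\<beta> = (1 - Re \<tau>1) / (1 - Re \<omega>) * \<alpha>"
    and "x1 = \<i> * ((1 + \<tau>1) / (1 - \<tau>1))"
  shows
    "\<phi> \<in> schur_class2 \<and> B_point \<phi> (\<tau>1, \<tau>2) \<and>
     has_nontangential_limit \<phi> (\<tau>1, \<tau>2) \<omega> \<and>
     has_angular_gradient \<phi> (\<tau>1, \<tau>2) (\<omega> * cnj \<tau>1 * of_real \<alpha>, 0)
     \<longleftrightarrow>
     (\<exists>g h. g \<in> pick_class2 \<and>
        ((\<lambda>y::real. of_real y * g (\<i> * ((1 + \<tau>1) / (1 - \<tau>1)) + \<i> * of_real y,
                                   \<i> * ((1 + \<tau>2) / (1 - \<tau>2)))) \<longlongrightarrow> 0) (at_right 0) \<and>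
        (\<forall>z1\<in>upper_half_plane. \<forall>z2\<in>upper_half_plane.
           h (z1, z2) = \<i> * ((1 + \<omega>) / (1 - \<omega>))
                        + 1 / (1 / (of_real \<beta> * (z1 - x1)) - g (z1, z2))) \<and>
        (\<forall>(l1, l2)\<in>bidisc.
           let z = (disc_to_half_plane l1, disc_to_half_plane l2)
           in \<phi> (l1, l2) = (h z - \<i>) / (h z + \<i>)))"
    (is "?data \<longleftrightarrow> (\<exists>g h. ?param g h)")
proof -
  note \<eta> = angular_derivative_constant[OF assms(1,3,6,7)]
  have Re_less: "Re a < 1" if "norm a = 1" "a \<noteq> 1" for a
  proof (rule ccontr)
    assume "\<not> Re a < 1"
    then have "Re a = 1" using complex_Re_le_cmod[of a] that(1) by linarith
    moreover from this have "Im a = 0" using cmod_power2[of a] that(1) by simp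
    ultimately show False using that(2) by (simp add: complex_eq_iff)
  qed
  have \<beta>: "\<beta> > 0"
    unfolding assms(7) using Re_less[OF assms(1,5)] Re_less[OF assms(3,6)] assms(4) by simp
  note D = disc_to_half_plane_def[symmetric]
  show ?thesis
    unfolding assms(8) D
  proof (intro iffI)
    assume data: "?data"
    obtain g where g: "g \<in> pick_class2"
      "((\<lambda>y::real. of_real y * g (disc_to_half_plane \<tau>1 + \<i> * of_real y, disc_to_half_plane \<tau>2))
        \<longlongrightarrow> 0) (at_right 0)"
      "\<And>l1 l2. (l1, l2) \<in> bidisc \<Longrightarrow> \<phi> (l1, l2) = half_plane_to_disc (disc_to_half_plane \<omega> +
        1 / (1 / (of_real \<beta> * (disc_to_half_plane l1 - disc_to_half_plane \<tau>1))
             - g (disc_to_half_plane l1, disc_to_half_plane l2)))"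
      using data
      by (elim conjE) (rule pick_parameter_of_angular_data[OF assms(1,5,2,3,6) \<beta> \<eta>], blast+)
    then show "\<exists>g h. g \<in> pick_class2 \<and>
        ((\<lambda>y::real. of_real y * g (disc_to_half_plane \<tau>1 + \<i> * of_real y, disc_to_half_plane \<tau>2))
          \<longlongrightarrow> 0) (at_right 0) \<and>
        (\<forall>z1\<in>upper_half_plane. \<forall>z2\<in>upper_half_plane.
           h (z1, z2) = disc_to_half_plane \<omega>
                        + 1 / (1 / (of_real \<beta> * (z1 - disc_to_half_plane \<tau>1)) - g (z1, z2))) \<and>
        (\<forall>(l1, l2)\<in>bidisc.
           let z = (disc_to_half_plane l1, disc_to_half_plane l2)
           in \<phi> (l1, l2) = (h z - \<i>) / (h z + \<i>))"
      by (intro exI[of _ g] exI[of _ "\<lambda>p. disc_to_half_plane \<omega> +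
          1 / (1 / (of_real \<beta> * (fst p - disc_to_half_plane \<tau>1)) - g p)"])
        (auto simp: half_plane_to_disc_def)
  next
    assume "\<exists>g h. g \<in> pick_class2 \<and>
        ((\<lambda>y::real. of_real y * g (disc_to_half_plane \<tau>1 + \<i> * of_real y, disc_to_half_plane \<tau>2))
          \<longlongrightarrow> 0) (at_right 0) \<and>
        (\<forall>z1\<in>upper_half_plane. \<forall>z2\<in>upper_half_plane.
           h (z1, z2) = disc_to_half_plane \<omega>
                        + 1 / (1 / (of_real \<beta> * (z1 - disc_to_half_plane \<tau>1)) - g (z1, z2))) \<and>
        (\<forall>(l1, l2)\<in>bidisc.
           let z = (disc_to_half_plane l1, disc_to_half_plane l2)
           in \<phi> (l1, l2) = (h z - \<i>) / (h z + \<i>))"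
    then obtain g h where g: "g \<in> pick_class2"
      "((\<lambda>y::real. of_real y * g (disc_to_half_plane \<tau>1 + \<i> * of_real y, disc_to_half_plane \<tau>2))
          \<longlongrightarrow> 0) (at_right 0)"
      and h: "\<forall>z1\<in>upper_half_plane. \<forall>z2\<in>upper_half_plane.
           h (z1, z2) = disc_to_half_plane \<omega>
                        + 1 / (1 / (of_real \<beta> * (z1 - disc_to_half_plane \<tau>1)) - g (z1, z2))"
      and \<phi>: "\<forall>(l1, l2)\<in>bidisc.
           let z = (disc_to_half_plane l1, disc_to_half_plane l2)
           in \<phi> (l1, l2) = (h z - \<i>) / (h z + \<i>)"
      by (elim exE conjE)
    have "\<phi> (l1, l2) = half_plane_to_disc (disc_to_half_plane \<omega> +
        1 / (1 / (of_real \<beta> * (disc_to_half_plane l1 - disc_to_half_plane \<tau>1))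
             - g (disc_to_half_plane l1, disc_to_half_plane l2)))" if l: "(l1, l2) \<in> bidisc" for l1 l2
    proof -
      have "disc_to_half_plane l1 \<in> upper_half_plane" "disc_to_half_plane l2 \<in> upper_half_plane"
        using l by (auto simp: mem_bidisc_iff Im_disc_to_half_plane_pos)
      then show ?thesis
        using h bspec[OF \<phi> l] by (simp add: half_plane_to_disc_def Let_def)
    qed
    from angular_data_of_pick_parameter[OF assms(1,5,2,3,6) \<beta> \<eta> g this]
    show "?data" by (intro conjI)
  qed
qed

end
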